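(* Let $k$ be a finite field of characteristic $p$ with an involution $\sigma$, $V$ a locally compact $k$-space, and $(V,h,q)$ a nondegenerate quadratic $\mathbb{F}_p$-space (over $\mathbb{F}_p$ with trivial involution) whose form $h$ is $\sigma$-adjoint, i.e. $h(ax,y)=h(x,\sigma(a)y)$ for all $a\in k$, $x,y\in V$. (1) If $\sigma\ne1$, there is a unique unitary $k$-space $(V,h',q')$ with $\mathrm{Tr}_{k/\mathbb{F}_p}h'=h$. Moreover, if $p\ne2$ or $(V,h,q)$ is symplectic, then $\mathrm{Tr}_{k/\mathbb{F}_p}q'=q$. (2) If $\sigma=1$, there is a unique nondegenerate quadratic $k$-space $(V,h',q')$ of the same type (orthogonal or symplectic) as $(V,h,q)$ with $\mathrm{Tr}_{k/\mathbb{F}_p}h'=h$ and $\mathrm{Tr}_{k/\mathbb{F}_p}q'=q$. (3) If $p=2$, $\sigma\ne1$ and $(V,h,q)$ is orthogonal, assume additionally that $\mathrm{Tr}_{k/\mathbb{F}_2}q'=q$. Let $X$ be a $k$-subspace of $V$. Then $X$ is maximal isotropic for $(V,h,q)$ if and only if it is maximal isotropic for $(V,h',q')$.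
   Context: $k$ carries the discrete topology. A locally compact $k$-space is a locally compact Hausdorff abelian group with a continuous $k$-vector space structure; subspaces are closed subspaces; $V^*$ is the space of continuous $k$-linear maps $V\to k$. A sesquilinear form is a continuous biadditive $s:V\times V\to k$ with $s(ax,y)=as(x,y)$, $s(x,ay)=\sigma(a)s(x,y)$; $s^*(x,y)=\sigma(s(y,x))$; for $\epsilon=\pm1$, $h$ is $\epsilon$-hermitian if $h=\epsilon h^*$; nondegenerate if $y\mapsto h(\cdot,y)$ is an isomorphism $V\to V^*$. A form parameter is an additive subgroup $\Lambda$ of $k$ with $\{a-\epsilon\sigma(a)\}\subseteq\Lambda\subseteq\{a:a=-\epsilon\sigma(a)\}$ and $a\sigma(a)\Lambda\subseteq\Lambda$. An $(\epsilon,\Lambda)$-quadratic space $(V,h,q)$ is associated to a sesquilinear $s$ (modulo forms $t$ with $t=-\epsilon t^*$, $t(v,v)\in\Lambda$) by $h=s+\epsilon s^*$, $q(v)=s(v,v)\bmod\Lambda$. Orthogonal: $\sigma=1,\epsilon=1,\Lambda=0$; symplectic: $\sigma=1,\epsilon=-1,\Lambda=k$; unitary: $\sigma\ne1$; all nondegenerate. The same definitions apply over $\mathbb{F}_p$ with trivial involution. $X$ is isotropic if $q(X)=0$ and $X\subseteq X^\perp$, maximal isotropic if moreover $X=X^\perp$. *)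

theory Defs
  imports
    "HOL-Analysis.Analysis"
    "HOL-Library.Set_Algebras"
    "Berlekamp_Zassenhaus.Finite_Field"
begin

definition field_involution :: "('f::field \<Rightarrow> 'f) \<Rightarrow> bool" where
  "field_involution \<sigma> \<longleftrightarrow> field_hom \<sigma> \<and> \<sigma> \<circ> \<sigma> = id"

definition locally_compact_vector_space ::
  "('f::field \<Rightarrow> 'v::{topological_ab_group_add,t2_space} \<Rightarrow> 'v) \<Rightarrow> bool" where
  "locally_compact_vector_space smul \<longleftrightarrow>
     vector_space smul \<and>
     locally_compact_space (euclidean :: 'v topology) \<and>
     continuous_map (prod_topology (discrete_topology UNIV) euclidean) euclidean
       (\<lambda>(a, v). smul a v)"

definition closed_subspace ::
  "('f::field \<Rightarrow> 'v::{topological_ab_group_add,t2_space} \<Rightarrow> 'v) \<Rightarrow> 'v set \<Rightarrow> bool" where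
  "closed_subspace smul X \<longleftrightarrow> module.subspace smul X \<and> closed X"

definition compact_open_topology ::
  "'a topology \<Rightarrow> 'b topology \<Rightarrow> ('a \<Rightarrow> 'b) topology" where
  "compact_open_topology A B =
     topology_generated_by
       {{f. continuous_map A B f \<and> f ` K \<subseteq> U} | K U. compactin A K \<and> openin B U}"

definition dual_space ::
  "('f::field \<Rightarrow> 'v::{topological_ab_group_add,t2_space} \<Rightarrow> 'v) \<Rightarrow> ('v \<Rightarrow> 'f) set" where
  "dual_space smul =
     {f. Vector_Spaces.linear smul (*) f \<and>
         continuous_map euclidean (discrete_topology UNIV) f}"

text \<open>As for Pontryagin duals, the dual carries the compact-open topology.\<close>

definition dual_topology ::
  "('f::field \<Rightarrow> 'v::{topological_ab_group_add,t2_space} \<Rightarrow> 'v) \<Rightarrow> ('v \<Rightarrow> 'f) topology" where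
  "dual_topology smul =
     subtopology (compact_open_topology euclidean (discrete_topology UNIV)) (dual_space smul)"

definition sesquilinear_form ::
  "('f::field \<Rightarrow> 'v::{topological_ab_group_add,t2_space} \<Rightarrow> 'v) \<Rightarrow> ('f \<Rightarrow> 'f) \<Rightarrow>
   ('v \<Rightarrow> 'v \<Rightarrow> 'f) \<Rightarrow> bool" where
  "sesquilinear_form smul \<sigma> s \<longleftrightarrow>
     continuous_map (prod_topology euclidean euclidean) (discrete_topology UNIV) (\<lambda>(x, y). s x y) \<and>
     (\<forall>x x' y. s (x + x') y = s x y + s x' y) \<and>
     (\<forall>x y y'. s x (y + y') = s x y + s x y') \<and>
     (\<forall>a x y. s (smul a x) y = a * s x y) \<and>
     (\<forall>a x y. s x (smul a y) = \<sigma> a * s x y)"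

definition adjoint_form :: "('f \<Rightarrow> 'f) \<Rightarrow> ('v \<Rightarrow> 'v \<Rightarrow> 'f) \<Rightarrow> 'v \<Rightarrow> 'v \<Rightarrow> 'f" where
  "adjoint_form \<sigma> s x y = \<sigma> (s y x)"

text \<open>
  The map sending y to h(-,y) is automatically additive and semilinear with respect to the
  involution, so being an isomorphism onto the dual means being a homeomorphism onto it.
\<close>

definition nondegenerate_form ::
  "('f::field \<Rightarrow> 'v::{topological_ab_group_add,t2_space} \<Rightarrow> 'v) \<Rightarrow> ('v \<Rightarrow> 'v \<Rightarrow> 'f) \<Rightarrow> bool" where
  "nondegenerate_form smul h \<longleftrightarrow>
     homeomorphic_map euclidean (dual_topology smul) (\<lambda>y x. h x y)"

definition form_parameter :: "('f::field \<Rightarrow> 'f) \<Rightarrow> 'f \<Rightarrow> 'f set \<Rightarrow> bool" where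
  "form_parameter \<sigma> \<epsilon> \<Lambda> \<longleftrightarrow>
     0 \<in> \<Lambda> \<and> (\<forall>a\<in>\<Lambda>. \<forall>b\<in>\<Lambda>. a - b \<in> \<Lambda>) \<and>
     {a - \<epsilon> * \<sigma> a | a. True} \<subseteq> \<Lambda> \<and> \<Lambda> \<subseteq> {a. a = - \<epsilon> * \<sigma> a} \<and>
     (\<forall>a. \<forall>l\<in>\<Lambda>. a * \<sigma> a * l \<in> \<Lambda>)"

text \<open>
  The values of q are elements of the quotient of the field by \<Lambda>, represented as cosets.
  A form s is only relevant up to forms t with t = - \<epsilon> t* and t(v,v) \<in> \<Lambda>;
  this ambiguity is precisely the ambiguity of s given the pair (h, q).
\<close>

definition quadratic_space ::
  "('f::field \<Rightarrow> 'v::{topological_ab_group_add,t2_space} \<Rightarrow> 'v) \<Rightarrow> ('f \<Rightarrow> 'f) \<Rightarrow> 'f \<Rightarrow> 'f set \<Rightarrow>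
   ('v \<Rightarrow> 'v \<Rightarrow> 'f) \<Rightarrow> ('v \<Rightarrow> 'f set) \<Rightarrow> bool" where
  "quadratic_space smul \<sigma> \<epsilon> \<Lambda> h q \<longleftrightarrow>
     (\<epsilon> = 1 \<or> \<epsilon> = - 1) \<and> form_parameter \<sigma> \<epsilon> \<Lambda> \<and>
     (\<exists>s. sesquilinear_form smul \<sigma> s \<and>
          h = (\<lambda>x y. s x y + \<epsilon> * adjoint_form \<sigma> s x y) \<and>
          q = (\<lambda>v. s v v +o \<Lambda>))"

definition nondegenerate_quadratic_space ::
  "('f::field \<Rightarrow> 'v::{topological_ab_group_add,t2_space} \<Rightarrow> 'v) \<Rightarrow> ('f \<Rightarrow> 'f) \<Rightarrow> 'f \<Rightarrow> 'f set \<Rightarrow>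
   ('v \<Rightarrow> 'v \<Rightarrow> 'f) \<Rightarrow> ('v \<Rightarrow> 'f set) \<Rightarrow> bool" where
  "nondegenerate_quadratic_space smul \<sigma> \<epsilon> \<Lambda> h q \<longleftrightarrow>
     quadratic_space smul \<sigma> \<epsilon> \<Lambda> h q \<and> nondegenerate_form smul h"

definition orthogonal_type :: "('f::field \<Rightarrow> 'f) \<Rightarrow> 'f \<Rightarrow> 'f set \<Rightarrow> bool" where
  "orthogonal_type \<sigma> \<epsilon> \<Lambda> \<longleftrightarrow> \<sigma> = id \<and> \<epsilon> = 1 \<and> \<Lambda> = {0}"

definition symplectic_type :: "('f::field \<Rightarrow> 'f) \<Rightarrow> 'f \<Rightarrow> 'f set \<Rightarrow> bool" where
  "symplectic_type \<sigma> \<epsilon> \<Lambda> \<longleftrightarrow> \<sigma> = id \<and> \<epsilon> = - 1 \<and> \<Lambda> = UNIV"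

definition unitary_space ::
  "('f::field \<Rightarrow> 'v::{topological_ab_group_add,t2_space} \<Rightarrow> 'v) \<Rightarrow> ('f \<Rightarrow> 'f) \<Rightarrow> 'f \<Rightarrow> 'f set \<Rightarrow>
   ('v \<Rightarrow> 'v \<Rightarrow> 'f) \<Rightarrow> ('v \<Rightarrow> 'f set) \<Rightarrow> bool" where
  "unitary_space smul \<sigma> \<epsilon> \<Lambda> h q \<longleftrightarrow>
     \<sigma> \<noteq> id \<and> nondegenerate_quadratic_space smul \<sigma> \<epsilon> \<Lambda> h q"

definition same_type ::
  "('f::field \<Rightarrow> 'f) \<Rightarrow> 'f \<Rightarrow> 'f set \<Rightarrow> ('g::field \<Rightarrow> 'g) \<Rightarrow> 'g \<Rightarrow> 'g set \<Rightarrow> bool" where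
  "same_type \<sigma> \<epsilon> \<Lambda> \<sigma>' \<epsilon>' \<Lambda>' \<longleftrightarrow>
     orthogonal_type \<sigma> \<epsilon> \<Lambda> \<and> orthogonal_type \<sigma>' \<epsilon>' \<Lambda>' \<or>
     symplectic_type \<sigma> \<epsilon> \<Lambda> \<and> symplectic_type \<sigma>' \<epsilon>' \<Lambda>'"

definition orthogonal_complement :: "('v \<Rightarrow> 'v \<Rightarrow> 'f::zero) \<Rightarrow> 'v set \<Rightarrow> 'v set" where
  "orthogonal_complement h X = {y. \<forall>x\<in>X. h x y = 0}"

text \<open>The zero element of the quotient by \<Lambda> is the coset \<Lambda> itself.\<close>

definition isotropic ::
  "'f::zero set \<Rightarrow> ('v \<Rightarrow> 'v \<Rightarrow> 'f) \<Rightarrow> ('v \<Rightarrow> 'f set) \<Rightarrow> 'v set \<Rightarrow> bool" where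
  "isotropic \<Lambda> h q X \<longleftrightarrow> (\<forall>x\<in>X. q x = \<Lambda>) \<and> X \<subseteq> orthogonal_complement h X"

definition maximal_isotropic ::
  "'f::zero set \<Rightarrow> ('v \<Rightarrow> 'v \<Rightarrow> 'f) \<Rightarrow> ('v \<Rightarrow> 'f set) \<Rightarrow> 'v set \<Rightarrow> bool" where
  "maximal_isotropic \<Lambda> h q X \<longleftrightarrow> isotropic \<Lambda> h q X \<and> X = orthogonal_complement h X"

text \<open>
  The prime field of p elements is the type mod_ring over a type of p elements. When p is the characteristic of
  the field k, the following is its unique embedding into k.
\<close>

definition of_prime_field :: "'p::prime_card mod_ring \<Rightarrow> 'k::field" where
  "of_prime_field c = of_int (to_int_mod_ring c)"

definition prime_smul ::
  "('k::field \<Rightarrow> 'v \<Rightarrow> 'v) \<Rightarrow> 'p::prime_card mod_ring \<Rightarrow> 'v \<Rightarrow> 'v" where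
  "prime_smul smul c v = smul (of_prime_field c) v"

text \<open>
  The trace of the Galois extension k of its prime field, as the sum of the conjugates.
  Every field automorphism fixes the prime field, so the Galois group consists of all
  automorphisms of k.
\<close>

definition prime_trace :: "'k::finite_field \<Rightarrow> 'p::prime_card mod_ring" where
  "prime_trace a = (THE c. of_prime_field c = (\<Sum>\<tau>\<in>{\<tau> :: 'k \<Rightarrow> 'k. field_isom \<tau>}. \<tau> a))"

definition trace_form_eq ::
  "('v \<Rightarrow> 'v \<Rightarrow> 'k::finite_field) \<Rightarrow> ('v \<Rightarrow> 'v \<Rightarrow> 'p::prime_card mod_ring) \<Rightarrow> bool" where
  "trace_form_eq h' h \<longleftrightarrow> (\<forall>x y. prime_trace (h' x y) = h x y)"

text \<open>
  Equality of the composite of q' with the map of quotients induced by the trace, and of q: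
  the trace of every representative of q'(v) represents q(v).
\<close>

definition trace_quadratic_eq ::
  "'p::prime_card mod_ring set \<Rightarrow> ('v \<Rightarrow> 'k::finite_field set) \<Rightarrow>
   ('v \<Rightarrow> 'p mod_ring set) \<Rightarrow> bool" where
  "trace_quadratic_eq \<Lambda> q' q \<longleftrightarrow> (\<forall>v. \<forall>a\<in>q' v. q v = prime_trace a +o \<Lambda>)"

end

(*
  Tr(ab) is a nondegenerate form on k, so h has a unique lift h' with Tr(a h'(x,y)) = h(ax,y), and h' inherits
  biadditivity, sesquilinearity and symmetry from h. It is nondegenerate because composition with Tr is an injective
  continuous map from the k-dual to the dual over the prime field, compatible with h' and h.

  If the involution is nontrivial, choose theta with theta + sigma(theta) = 1: the form theta h' defines a unitary space,
  and both the form parameter and q'(v) = {a. a + eps sigma(a) = h'(v,v)} are determined by h'.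
  If it is trivial and h comes from s, let (u_i), (w_i) be dual bases for Tr(ab). The form t(x,y) = sum_i s(u_i x, w_i y) satisfies
  t(ax,y) = t(x,ay), and its lift defines the required space since sum_i u_i w_i = 1; in characteristic 2 the trace of
  its values on the diagonal is correct because s is symmetric on each line k v.

  The orthogonal complements of a k-subspace for h and for h' agree, which reduces the last part to the values of q and q'.
*)
theory Submission
  imports Defs
begin

text \<open>The form t answers an obstacle: only h is adjoint, while an s representing it need not
  satisfy s(ax,y) = s(x,ay), so the lift of s itself need not be linear in the second argument. In
  odd characteristic h/2 could serve as s, but in characteristic 2 the map q carries more
  information than h and has to be lifted through some s. The element sum_i u_i (x) w_i of the
  tensor square of k is symmetric, it is balanced (multiplying the left or the right factors by a
  gives the same result), and multiplication sends it to 1. It is thus the separability idempotent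
  of k, and t is s averaged by it. That the product sum is 1 and that the trace form is
  nondegenerate both come from the linear independence of automorphisms. A nontrivial involution
  calls for no averaging: additive Hilbert 90 makes the largest and the smallest form parameter
  equal, so h' already contains q'. With the trivial involution in characteristic 2, q' is recovered
  from q on a whole line kv, where its traces are tr(c^2 a), because squares exhaust k.\<close>

section \<open>Sesquilinear forms and the dual space\<close>

text \<open>The common fibres of the finitely many maps \<open>f a\<close> are open and
  \<open>g\<close> is constant on each, so a preimage under \<open>g\<close> is a union of them.
  Since \<open>k\<close> is finite, the family may be indexed by all scalars.\<close>

lemma continuous_map_discrete_factor:
  assumes "finite A" and cont: "\<And>a. a \<in> A \<Longrightarrow> continuous_map X (discrete_topology UNIV) (f a)"
    and factor: "\<And>x y. (\<And>a. a \<in> A \<Longrightarrow> f a x = f a y) \<Longrightarrow> g x = g y"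
  shows "continuous_map X (discrete_topology UNIV) g"
  unfolding continuous_map_def
proof (intro conjI allI impI)
  fix U
  let ?N = "\<lambda>y. topspace X \<inter> (\<Inter>a\<in>A. {x \<in> topspace X. f a x \<in> {f a y}})"
  have N: "openin X (?N y)" for y
  proof (cases "A = {}")
    case False
    have "openin X {x \<in> topspace X. f a x \<in> {f a y}}" if "a \<in> A" for a
      by (rule openin_continuous_map_preimage[OF cont[OF that]]) simp
    then show ?thesis using False \<open>finite A\<close> by (intro openin_Int openin_INT2) auto
  qed simp
  have "{x \<in> topspace X. g x \<in> U} = (\<Union>y\<in>{x \<in> topspace X. g x \<in> U}. ?N y)"
    (is "?L = ?R")
  proof
    show "?R \<subseteq> ?L"
    proof
      fix x assume "x \<in> ?R"
      then obtain y where y: "g y \<in> U" "x \<in> topspace X" "\<And>a. a \<in> A \<Longrightarrow> f a x = f a y" by auto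
      then have "g x = g y" by (intro factor)
      then show "x \<in> ?L" using y by simp
    qed
  qed auto
  then show "openin X {x \<in> topspace X. g x \<in> U}" using N by (metis (no_types, lifting) imageE openin_Union)
qed simp

lemma topspace_compact_open_discrete:
  "topspace (compact_open_topology euclidean (discrete_topology UNIV)) =
     {f. continuous_map euclidean (discrete_topology UNIV) f}"
proof -
  have "{f. continuous_map euclidean (discrete_topology UNIV) f} \<in>
      {{f :: 'a \<Rightarrow> 'b. continuous_map euclidean (discrete_topology UNIV) f \<and> f ` K \<subseteq> U} | K U.
        compactin euclidean K \<and> openin (discrete_topology UNIV) U}"
    by (intro CollectI exI[of _ "{}"] exI[of _ UNIV]) simp
  then show ?thesis
    unfolding compact_open_topology_def topology_generated_by_topspace by blast
qed

lemma topspace_dual_topology: "topspace (dual_topology smul) = dual_space smul"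
  by (auto simp: dual_topology_def topspace_compact_open_discrete dual_space_def)

lemma continuous_map_into_dual_topology:
  fixes F :: "'a \<Rightarrow> 'v::{topological_ab_group_add,t2_space} \<Rightarrow> 'f::field"
  assumes dual: "\<And>y. y \<in> topspace X \<Longrightarrow> F y \<in> dual_space smul"
    and open_preimage: "\<And>K U. compact K \<Longrightarrow> openin X {y \<in> topspace X. F y ` K \<subseteq> U}"
  shows "continuous_map X (dual_topology smul) F"
  unfolding dual_topology_def
proof (rule continuous_map_into_subtopology)
  show "F \<in> topspace X \<rightarrow> dual_space smul" using dual by simp
  show "continuous_map X (compact_open_topology euclidean (discrete_topology UNIV)) F"
    unfolding compact_open_topology_def
  proof (rule continuous_on_generated_topo)
    fix W :: "('v \<Rightarrow> 'f) set" assume "W \<in> {{f. continuous_map euclidean (discrete_topology UNIV) f \<and> f ` K \<subseteq> U} | K U.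
        compactin euclidean K \<and> openin (discrete_topology UNIV) U}"
    then obtain K U where KU: "compact K"
      "W = {f. continuous_map euclidean (discrete_topology UNIV) f \<and> f ` K \<subseteq> U}" by auto
    have "F -` W \<inter> topspace X = {y \<in> topspace X. F y ` K \<subseteq> U}"
      using dual by (auto simp: KU dual_space_def)
    then show "openin X (F -` W \<inter> topspace X)" using open_preimage[OF KU(1)] by simp
  next
    show "F ` topspace X \<subseteq> \<Union> {{f. continuous_map euclidean (discrete_topology UNIV) f \<and> f ` K \<subseteq> U} | K U.
        compactin euclidean K \<and> openin (discrete_topology UNIV) U}"
      using dual topspace_compact_open_discrete
      unfolding compact_open_topology_def topology_generated_by_topspace dual_space_def by blast
  qed
qed

lemma openin_dual_topology_subbasis:
  fixes smul :: "'f::field \<Rightarrow> 'v::{topological_ab_group_add,t2_space} \<Rightarrow> 'v"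
  assumes "compact K"
  shows "openin (dual_topology smul) {f \<in> dual_space smul. f ` K \<subseteq> U}"
proof -
  have "openin (compact_open_topology euclidean (discrete_topology UNIV))
      {f. continuous_map euclidean (discrete_topology UNIV) f \<and> f ` K \<subseteq> U}"
    unfolding compact_open_topology_def using assms
    by (intro topology_generated_by_Basis) auto
  then show ?thesis
    unfolding dual_topology_def openin_subtopology
    by (intro exI conjI) (auto simp: dual_space_def)
qed

lemma sesquilinear_formD:
  assumes "sesquilinear_form smul \<sigma> s"
  shows "continuous_map euclidean (discrete_topology UNIV) (\<lambda>(x, y). s x y)"
    "s (x + x') y = s x y + s x' y" "s x (y + y') = s x y + s x y'"
    "s (smul a x) y = a * s x y" "s x (smul a y) = \<sigma> a * s x y"
  using assms by (auto simp: sesquilinear_form_def)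

lemma linear_iff_vector_spaces:
  "Vector_Spaces.linear s1 s2 f \<longleftrightarrow> vector_space s1 \<and> vector_space s2 \<and>
     (\<forall>x y. f (x + y) = f x + f y) \<and> (\<forall>c x. f (s1 c x) = s2 c (f x))"
  by (auto simp: Vector_Spaces.linear_def module_hom_def module_hom_axioms_def vector_space_def Modules.module_def)

lemma vector_space_mult: "vector_space ((*) :: 'f::field \<Rightarrow> _)"
  by unfold_locales (simp_all add: algebra_simps)

lemma sesquilinear_form_slice:
  assumes s: "sesquilinear_form smul \<sigma> s" and smul: "vector_space smul"
  shows "(\<lambda>x. s x y) \<in> dual_space smul"
proof -
  have "continuous_map euclidean (discrete_topology UNIV) ((\<lambda>(x, y). s x y) \<circ> (\<lambda>x. (x, y)))"
    by (rule continuous_map_compose[OF _ sesquilinear_formD(1)[OF s]])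
      (auto intro!: continuous_intros)
  then show ?thesis
    using sesquilinear_formD(2,4)[OF s] smul vector_space_mult
    by (simp add: dual_space_def linear_iff_vector_spaces o_def)
qed

text \<open>The pairs on which the form takes values in \<open>U\<close> are an open set. If it
  contains all pairs of points of a compact \<open>K\<close> with \<open>y\<close>, the tube lemma
  lets \<open>y\<close> vary in a neighbourhood.\<close>

lemma continuous_map_form_slice:
  fixes smul :: "'f::field \<Rightarrow> 'v::{topological_ab_group_add,t2_space} \<Rightarrow> 'v"
  assumes s: "sesquilinear_form smul \<sigma> s" and smul: "vector_space smul"
  shows "continuous_map euclidean (dual_topology smul) (\<lambda>y x. s x y)"
proof (rule continuous_map_into_dual_topology)
  show "(\<lambda>x. s x y) \<in> dual_space smul" for y
    by (rule sesquilinear_form_slice[OF s smul])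
  fix K :: "'v set" and U :: "'f set" assume K: "compact K"
  define W where "W = (\<lambda>(x, y). s x y) -` U"
  have "openin euclidean {z \<in> topspace euclidean. (\<lambda>(x, y). s x y) z \<in> U}"
    by (rule openin_continuous_map_preimage[OF sesquilinear_formD(1)[OF s]]) simp
  then have W: "open W" by (simp add: W_def vimage_def)
  \<comment> \<open>The coordinates are swapped because the tube lemma takes the compact factor in
    second place.\<close>
  have "open ((\<lambda>(x, y). (y, x)) -` W)"
    by (rule open_vimage[OF W]) (auto intro!: continuous_intros simp: case_prod_beta)
  then have W': "open {(y, x). s x y \<in> U}" (is "open ?W'")
    by (simp add: W_def vimage_def case_prod_beta')
  have "\<exists>Y. open Y \<and> y \<in> Y \<and> Y \<subseteq> {y. (\<lambda>x. s x y) ` K \<subseteq> U}" if "(\<lambda>x. s x y) ` K \<subseteq> U" for y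
    using Elementary_Topology.tube_lemma[OF K W', of y] that by fastforce
  then have "open {y. (\<lambda>x. s x y) ` K \<subseteq> U}" by (intro Topological_Spaces.openI) (simp only: mem_Collect_eq)
  then show "openin euclidean {y \<in> topspace euclidean. (\<lambda>x. s x y) ` K \<subseteq> U}" by simp
qed

lemma vector_spaceD:
  assumes "vector_space smul"
  shows "smul a (x + y) = smul a x + smul a y" "smul (a + b) x = smul a x + smul b x"
    "smul a (smul b x) = smul (a * b) x" "smul 1 x = x" "smul 0 x = 0" "smul a 0 = 0"
proof -
  interpret vector_space smul by fact
  show "smul a (x + y) = smul a x + smul a y" "smul (a + b) x = smul a x + smul b x"
    "smul a (smul b x) = smul (a * b) x" "smul 1 x = x" "smul 0 x = 0" "smul a 0 = 0"
    by (simp_all add: scale_right_distrib scale_left_distrib)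
qed

lemma continuous_smul:
  assumes "locally_compact_vector_space smul"
  shows "continuous_on UNIV (smul a)"
proof -
  have "continuous_map euclidean euclidean ((\<lambda>(a, v). smul a v) \<circ> (\<lambda>v. (a, v)))"
    using assms unfolding locally_compact_vector_space_def
    by (intro continuous_map_compose[of _ "prod_topology (discrete_topology UNIV) euclidean"])
      (auto intro!: continuous_map_pairedI)
  then show ?thesis by (simp add: o_def)
qed

lemma continuous_map_form_smul:
  assumes s: "continuous_map euclidean (discrete_topology UNIV) (\<lambda>(x, y). s x y)"
    and V: "locally_compact_vector_space smul"
  shows "continuous_map euclidean (discrete_topology UNIV) (\<lambda>(x, y). s (smul a x) (smul b y))"
proof -
  have "continuous_map euclidean (discrete_topology UNIV)
      ((\<lambda>(x, y). s x y) \<circ> (\<lambda>z. (smul a (fst z), smul b (snd z))))"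
    by (rule continuous_map_compose[OF _ s])
      (auto intro!: continuous_on_Pair continuous_on_compose2[OF continuous_smul[OF V]] continuous_intros)
  then show ?thesis by (simp add: o_def case_prod_beta')
qed

section \<open>Quadratic spaces\<close>

lemma elt_set_plus_UNIV: "(a::'a::ab_group_add) +o UNIV = UNIV"
proof -
  have "b \<in> a +o UNIV" for b using set_plus_intro2[of "b - a" UNIV a] by simp
  then show ?thesis by blast
qed

lemma field_involutionD:
  assumes "field_involution \<sigma>"
  shows "\<sigma> (a + b) = \<sigma> a + \<sigma> b" "\<sigma> (a * b) = \<sigma> a * \<sigma> b" "\<sigma> 0 = 0" "\<sigma> 1 = 1"
    "\<sigma> (- a) = - \<sigma> a" "\<sigma> (\<sigma> a) = a"
proof -
  interpret field_hom \<sigma> using assms by (simp add: field_involution_def)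
  show "\<sigma> (a + b) = \<sigma> a + \<sigma> b" "\<sigma> (a * b) = \<sigma> a * \<sigma> b" "\<sigma> 0 = 0" "\<sigma> 1 = 1"
    by (simp_all add: hom_add hom_mult)
  show "\<sigma> (- a) = - \<sigma> a" by (rule hom_uminus)
  show "\<sigma> (\<sigma> a) = a" using assms by (metis comp_apply field_involution_def id_apply)
qed

lemma field_involution_id: "field_involution (id :: 'f::field \<Rightarrow> 'f)"
proof -
  have "field_hom (id :: 'f \<Rightarrow> 'f)" by unfold_locales auto
  then show ?thesis by (simp add: field_involution_def)
qed

lemma field_involution_isom:
  assumes "field_involution \<sigma>"
  shows "field_isom \<sigma>"
proof -
  have "surj \<sigma>" using field_involutionD(6)[OF assms] by (rule surjI)
  then show ?thesis using assms by (simp add: field_isom_def field_involution_def surjective_def)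
qed

lemma field_involution_sign:
  assumes "field_involution \<sigma>" "\<epsilon> = 1 \<or> \<epsilon> = - 1"
  shows "\<sigma> \<epsilon> = \<epsilon>" "\<epsilon> * \<epsilon> = 1"
  using assms by (auto simp: field_involutionD)

lemma quadratic_space_sign: "quadratic_space smul \<sigma> \<epsilon> \<Lambda> h q \<Longrightarrow> \<epsilon> = 1 \<or> \<epsilon> = - 1"
  by (simp add: quadratic_space_def)

lemma quadratic_space_sesquilinear:
  fixes smul :: "'f::field \<Rightarrow> 'v::{topological_ab_group_add,t2_space} \<Rightarrow> 'v"
  assumes Q: "quadratic_space smul \<sigma> \<epsilon> \<Lambda> h q" and \<sigma>: "field_involution \<sigma>"
  shows "sesquilinear_form smul \<sigma> h"
proof -
  obtain s where s: "sesquilinear_form smul \<sigma> s"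
    and h: "h = (\<lambda>x y. s x y + \<epsilon> * adjoint_form \<sigma> s x y)"
    using Q by (auto simp: quadratic_space_def)
  note cont = sesquilinear_formD(1)[OF s]
  have swap: "continuous_map euclidean (discrete_topology UNIV) (\<lambda>(x, y). s y x)"
  proof -
    have "continuous_map euclidean (discrete_topology UNIV) ((\<lambda>(x, y). s x y) \<circ> (\<lambda>z. (snd z, fst z)))"
      by (rule continuous_map_compose[OF _ cont]) (auto intro!: continuous_intros)
    then show ?thesis by (simp add: o_def case_prod_beta')
  qed
  have "continuous_map euclidean (discrete_topology UNIV) (\<lambda>(x, y). h x y)"
  \<comment> \<open>\<open>h x y\<close> depends only on the two values \<open>s x y\<close> and
    \<open>s y x\<close>; the index set is the type of booleans.\<close>
  proof (rule continuous_map_discrete_factor[where A = UNIV])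
    show "continuous_map euclidean (discrete_topology UNIV) (\<lambda>(x, y). if b then s x y else s y x)" for b
      using cont swap by (cases b) simp_all
    fix z z' :: "'v \<times> 'v"
    assume *: "\<And>b. b \<in> UNIV \<Longrightarrow>
      (\<lambda>(x, y). if b then s x y else s y x) z = (\<lambda>(x, y). if b then s x y else s y x) z'"
    show "(\<lambda>(x, y). h x y) z = (\<lambda>(x, y). h x y) z'"
      using *[of True] *[of False] by (simp add: h adjoint_form_def case_prod_beta')
  qed simp
  then show ?thesis
    by (simp add: sesquilinear_form_def h adjoint_form_def sesquilinear_formD[OF s] field_involutionD[OF \<sigma>]
        algebra_simps)
qed

lemma quadratic_space_hermitian:
  assumes Q: "quadratic_space smul \<sigma> \<epsilon> \<Lambda> h q" and \<sigma>: "field_involution \<sigma>"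
  shows "h x y = \<epsilon> * \<sigma> (h y x)"
proof -
  obtain s where h: "h = (\<lambda>x y. s x y + \<epsilon> * adjoint_form \<sigma> s x y)"
    using Q by (auto simp: quadratic_space_def)
  show ?thesis
    using field_involution_sign[OF \<sigma> quadratic_space_sign[OF Q]]
    by (simp add: h adjoint_form_def field_involutionD[OF \<sigma>] distrib_left flip: mult.assoc)
qed

text \<open>The map a -> a + \<epsilon> \<sigma>(a) kills the form parameter, so it is well defined
  on the coset \<open>q v\<close>, and on \<open>s v v\<close> it gives
  \<open>h v v\<close>.\<close>

lemma quadratic_space_value:
  assumes Q: "quadratic_space smul \<sigma> \<epsilon> \<Lambda> h q" and \<sigma>: "field_involution \<sigma>"
    and a: "a \<in> q v"
  shows "a + \<epsilon> * \<sigma> a = h v v"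
proof -
  obtain s where h: "h = (\<lambda>x y. s x y + \<epsilon> * adjoint_form \<sigma> s x y)"
    and q: "q = (\<lambda>v. s v v +o \<Lambda>)" and \<Lambda>: "\<Lambda> \<subseteq> {a. a = - \<epsilon> * \<sigma> a}"
    using Q by (auto simp: quadratic_space_def form_parameter_def)
  obtain l where l: "l \<in> \<Lambda>" "a = s v v + l"
    using a by (auto simp: q elt_set_plus_def)
  have "l = - \<epsilon> * \<sigma> l" using \<Lambda> l(1) by auto
  then have "l + \<epsilon> * \<sigma> l = 0" by (metis ab_group_add_class.ab_left_minus add.commute minus_mult_left minus_minus)
  then show ?thesis
    by (simp add: h adjoint_form_def l(2) field_involutionD[OF \<sigma>] distrib_left add_ac)
qed

lemma quadratic_space_coset:
  assumes Q: "quadratic_space smul \<sigma> \<epsilon> \<Lambda> h q"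
  shows "\<exists>a. a \<in> q v" and "a \<in> q v \<Longrightarrow> q v = a +o \<Lambda>" and "q v = \<Lambda> \<longleftrightarrow> 0 \<in> q v"
proof -
  obtain s where q: "q = (\<lambda>v. s v v +o \<Lambda>)" and "form_parameter \<sigma> \<epsilon> \<Lambda>"
    using Q by (auto simp: quadratic_space_def)
  then have 0: "0 \<in> \<Lambda>" and diff: "\<And>a b. a \<in> \<Lambda> \<Longrightarrow> b \<in> \<Lambda> \<Longrightarrow> a - b \<in> \<Lambda>"
    by (auto simp: form_parameter_def)
  have add: "a + b \<in> \<Lambda>" if "a \<in> \<Lambda>" "b \<in> \<Lambda>" for a b
    using diff[OF that(1) diff[OF 0 that(2)]] by simp
  show "\<exists>a. a \<in> q v" using 0 by (auto simp: q elt_set_plus_def)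
  show coset: "q v = a +o \<Lambda>" if "a \<in> q v" for a
  proof -
    obtain l where l: "l \<in> \<Lambda>" "a = s v v + l" using \<open>a \<in> q v\<close> by (auto simp: q elt_set_plus_def)
    have "s v v + b \<in> (s v v + l) +o \<Lambda>" if "b \<in> \<Lambda>" for b
      using diff[OF that l(1)] by (auto simp: elt_set_plus_def intro!: bexI[of _ "b - l"])
    moreover have "(s v v + l) + b \<in> s v v +o \<Lambda>" if "b \<in> \<Lambda>" for b
      using add[OF l(1) that] by (auto simp: elt_set_plus_def add.assoc)
    ultimately show ?thesis by (auto simp: q l(2) elt_set_plus_def)
  qed
  show "q v = \<Lambda> \<longleftrightarrow> 0 \<in> q v" using coset[of 0] 0 by auto
qed

lemma quadratic_space_UNIV:
  assumes "quadratic_space smul \<sigma> \<epsilon> UNIV h q"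
  shows "q v = UNIV"
proof -
  obtain a where "a \<in> q v" using quadratic_space_coset(1)[OF assms] by blast
  then show ?thesis using quadratic_space_coset(2)[OF assms] by (simp only: elt_set_plus_UNIV)
qed

text \<open>Closure of \<open>\<Lambda>\<close> under multiplication by
  \<open>c * \<sigma> c\<close> lets the scaling law of s(v,v) pass to cosets.\<close>

lemma quadratic_space_scale:
  assumes Q: "quadratic_space smul \<sigma> \<epsilon> \<Lambda> h q" and a: "a \<in> q v"
  shows "c * \<sigma> c * a \<in> q (smul c v)"
proof -
  obtain s where q: "q = (\<lambda>v. s v v +o \<Lambda>)" and \<Lambda>: "\<And>a l. l \<in> \<Lambda> \<Longrightarrow> a * \<sigma> a * l \<in> \<Lambda>"
    and s: "sesquilinear_form smul \<sigma> s"
    using Q by (auto simp: quadratic_space_def form_parameter_def)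
  obtain l where l: "l \<in> \<Lambda>" "a = s v v + l" using a by (auto simp: q elt_set_plus_def)
  have "c * \<sigma> c * a = s (smul c v) (smul c v) + c * \<sigma> c * l"
    by (simp add: l(2) sesquilinear_formD[OF s] algebra_simps)
  then show ?thesis using \<Lambda>[OF l(1)] by (auto simp: q elt_set_plus_def)
qed

text \<open>This \<open>\<theta>\<close> replaces 1/2 in every characteristic. If b + \<sigma>(b)
  were always 0, then b = 1 would give characteristic 2, where \<sigma>(b) = -b = b contradicts
  nontriviality.\<close>

lemma nontrivial_involution_trace_1:
  assumes \<sigma>: "field_involution \<sigma>" and "\<sigma> \<noteq> id"
  obtains \<theta> where "\<theta> + \<sigma> \<theta> = 1"
proof -
  have "\<exists>b. b + \<sigma> b \<noteq> 0"
  proof (rule ccontr)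
    assume "\<not> ?thesis"
    then have *: "b + \<sigma> b = 0" for b by blast
    have "(1::'a) + 1 = 0" using *[of 1] by (simp add: field_involutionD[OF \<sigma>])
    then have "b + b = 0" for b :: 'a by (metis distrib_left mult.right_neutral mult_zero_right)
    then have "\<sigma> b = b" for b using *[of b] by (metis add_left_imp_eq)
    then show False using \<open>\<sigma> \<noteq> id\<close> by auto
  qed
  then obtain b where b: "b + \<sigma> b \<noteq> 0" ..
  \<comment> \<open>Since b + \<sigma>(b) is fixed by \<open>\<sigma>\<close>, so is its inverse
    \<open>c\<close>, and multiplying \<open>b\<close> by \<open>c\<close> normalises the sum to
    1.\<close>
  define c where "c = inverse (b + \<sigma> b)"
  have c: "c * (b + \<sigma> b) = 1" using b by (simp add: c_def)
  have "\<sigma> c * (b + \<sigma> b) = \<sigma> (c * (b + \<sigma> b))"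
    by (simp add: field_involutionD[OF \<sigma>] add.commute)
  then have "\<sigma> c * (b + \<sigma> b) = c * (b + \<sigma> b)" using c by (simp add: field_involutionD[OF \<sigma>])
  then have "\<sigma> c = c" using b by simp
  then have "c * b + \<sigma> (c * b) = 1" using c by (simp add: field_involutionD[OF \<sigma>] distrib_left)
  then show ?thesis by (rule that)
qed

text \<open>Additive Hilbert 90 leaves only one form parameter when the involution is nontrivial.\<close>

lemma form_parameter_nontrivial_involution:
  assumes \<sigma>: "field_involution \<sigma>" and "\<sigma> \<noteq> id" and \<epsilon>: "\<epsilon> = 1 \<or> \<epsilon> = - 1"
  shows "form_parameter \<sigma> \<epsilon> \<Lambda> \<longleftrightarrow> \<Lambda> = {a. a = - \<epsilon> * \<sigma> a}"
proof
  assume \<Lambda>: "form_parameter \<sigma> \<epsilon> \<Lambda>"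
  obtain \<theta> where \<theta>: "\<theta> + \<sigma> \<theta> = 1" using nontrivial_involution_trace_1[OF assms(1,2)] .
  have "a \<in> \<Lambda>" if a: "a = - \<epsilon> * \<sigma> a" for a
  proof -
    \<comment> \<open>For \<open>a\<close> in the largest form parameter, -\<epsilon> \<sigma>(a) is
      \<open>a\<close> again, so \<open>\<theta> * a\<close> witnesses that \<open>a\<close> lies in
      the smallest one.\<close>
    have "\<theta> * a - \<epsilon> * \<sigma> (\<theta> * a) = \<theta> * a + \<sigma> \<theta> * (- \<epsilon> * \<sigma> a)"
      by (simp add: field_involutionD[OF \<sigma>])
    also have "\<dots> = (\<theta> + \<sigma> \<theta>) * a" by (simp only: a[symmetric] distrib_right)
    finally have "a = \<theta> * a - \<epsilon> * \<sigma> (\<theta> * a)" by (simp add: \<theta>)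
    then show ?thesis using \<Lambda> unfolding form_parameter_def by blast
  qed
  then show "\<Lambda> = {a. a = - \<epsilon> * \<sigma> a}" using \<Lambda> unfolding form_parameter_def by blast
next
  note sign = field_involution_sign[OF \<sigma> \<epsilon>]
  assume \<Lambda>: "\<Lambda> = {a. a = - \<epsilon> * \<sigma> a}"
  have "0 = - \<epsilon> * \<sigma> 0" by (simp add: field_involutionD[OF \<sigma>])
  moreover have "a - b = - \<epsilon> * \<sigma> (a - b)" if "a = - \<epsilon> * \<sigma> a" "b = - \<epsilon> * \<sigma> b" for a b
  proof -
    have "- \<epsilon> * \<sigma> (a + - b) = - \<epsilon> * \<sigma> a - (- \<epsilon> * \<sigma> b)"
      by (simp only: field_involutionD[OF \<sigma>]) (simp add: algebra_simps)
    then show ?thesis by (simp only: that[symmetric] diff_conv_add_uminus[symmetric])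
  qed
  moreover have "a - \<epsilon> * \<sigma> a = - \<epsilon> * \<sigma> (a - \<epsilon> * \<sigma> a)" for a
  proof -
    have "- \<epsilon> * \<sigma> (a + - (\<epsilon> * \<sigma> a)) = - \<epsilon> * \<sigma> a + (\<epsilon> * \<epsilon>) * a"
      by (simp only: field_involutionD[OF \<sigma>] sign(1)) (simp add: algebra_simps)
    also have "(\<epsilon> * \<epsilon>) * a = a" by (simp only: sign mult_1_left)
    finally show ?thesis by simp
  qed
  moreover have "b * \<sigma> b * a = - \<epsilon> * \<sigma> (b * \<sigma> b * a)" if "a = - \<epsilon> * \<sigma> a" for a b
  proof -
    have "- \<epsilon> * \<sigma> (b * \<sigma> b * a) = b * \<sigma> b * (- \<epsilon> * \<sigma> a)"
      by (simp add: field_involutionD[OF \<sigma>])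
    then show ?thesis by (simp only: that[symmetric])
  qed
  ultimately show "form_parameter \<sigma> \<epsilon> \<Lambda>"
    unfolding form_parameter_def \<Lambda> by blast
qed

text \<open>The form parameter is the whole kernel of a -> a + \<epsilon> \<sigma>(a), so the coset
  \<open>q v\<close> is the entire fibre over \<open>h v v\<close>.\<close>

lemma unitary_space_determined:
  assumes U: "unitary_space smul \<sigma> \<epsilon> \<Lambda> h q" and \<sigma>: "field_involution \<sigma>"
  shows "\<Lambda> = {a. a = - \<epsilon> * \<sigma> a}" and "q v = {a. a + \<epsilon> * \<sigma> a = h v v}"
proof -
  have Q: "quadratic_space smul \<sigma> \<epsilon> \<Lambda> h q" and "\<sigma> \<noteq> id"
    using U by (simp_all add: unitary_space_def nondegenerate_quadratic_space_def)
  then show \<Lambda>: "\<Lambda> = {a. a = - \<epsilon> * \<sigma> a}"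
    using form_parameter_nontrivial_involution[OF \<sigma> _ quadratic_space_sign[OF Q], of \<Lambda>]
    by (simp add: quadratic_space_def)
  obtain b where b: "b \<in> q v" using quadratic_space_coset(1)[OF Q] by blast
  have "a \<in> q v" if "a + \<epsilon> * \<sigma> a = h v v" for a
  proof -
    have "a + \<epsilon> * \<sigma> a = b + \<epsilon> * \<sigma> b"
      using that quadratic_space_value[OF Q \<sigma> b] by simp
    moreover have "- \<epsilon> * \<sigma> (a + - b) = - (\<epsilon> * \<sigma> a) + \<epsilon> * \<sigma> b"
      by (simp only: field_involutionD[OF \<sigma>]) (simp add: algebra_simps)
    ultimately have "a - b = - \<epsilon> * \<sigma> (a - b)" by (simp add: algebra_simps)
    then have "b + (a - b) \<in> b +o \<Lambda>" unfolding \<Lambda> elt_set_plus_def by blast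
    then show ?thesis using quadratic_space_coset(2)[OF Q b] by simp
  qed
  then show "q v = {a. a + \<epsilon> * \<sigma> a = h v v}" using quadratic_space_value[OF Q \<sigma>] by blast
qed

section \<open>Form parameters over the prime field\<close>

lemma two_eq_0_iff_mod_ring: "(2 :: 'p::prime_card mod_ring) = 0 \<longleftrightarrow> CARD('p) = 2"
proof -
  have "(of_nat 2 :: 'p mod_ring) = 0 \<longleftrightarrow> CARD('p) dvd 2"
    by (subst of_nat_eq_0_iff_char_dvd) simp
  also have "\<dots> \<longleftrightarrow> CARD('p) = 2"
    using prime_card[where 'a = 'p] by (metis dvd_refl primes_dvd_imp_eq two_is_prime_nat)
  finally show ?thesis by simp
qed

text \<open>For odd p the lower and upper bounds on a form parameter coincide, being 0 for sign 1
  and everything for sign -1. For p = 2 the signs agree and \<open>\<Lambda>\<close> alone decides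
  the type.\<close>

lemma prime_field_form_type:
  assumes "form_parameter id \<epsilon> (\<Lambda> :: 'p::prime_card mod_ring set)" and "\<epsilon> = 1 \<or> \<epsilon> = - 1"
  shows "orthogonal_type id \<epsilon> \<Lambda> \<or> symplectic_type id \<epsilon> \<Lambda>"
proof -
  have 0: "0 \<in> \<Lambda>" and even: "\<And>a. a - \<epsilon> * a \<in> \<Lambda>" and max: "\<And>a. a \<in> \<Lambda> \<Longrightarrow> a = - \<epsilon> * a"
    and sq: "\<And>a l. l \<in> \<Lambda> \<Longrightarrow> a * a * l \<in> \<Lambda>"
    using assms(1) unfolding form_parameter_def id_apply by blast+
  show ?thesis
  proof (cases "CARD('p) = 2")
    case True
    then have "(2 :: 'p mod_ring) = 0" by (simp add: two_eq_0_iff_mod_ring)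
    then have "(1 :: 'p mod_ring) = - 1" by (simp add: eq_neg_iff_add_eq_0)
    then have \<epsilon>: "\<epsilon> = 1" "\<epsilon> = - 1" using assms(2) by auto
    have "\<Lambda> = UNIV" if l: "l \<in> \<Lambda>" "l \<noteq> 0" for l
    proof -
      have "b \<in> \<Lambda>" for b
      proof -
        \<comment> \<open>Squaring is the identity on F_2, so closure under multiplication by
          squares carries \<open>l\<close> to any \<open>b\<close>.\<close>
        have "(b / l) * (b / l) = b / l"
          using finite_field_power_card_eq_same[of "b / l"] True by (simp add: power2_eq_square)
        then have "(b / l) * (b / l) * l = b" using l(2) by simp
        then show ?thesis using sq[OF l(1), of "b / l"] by (simp only:)
      qed
      then show ?thesis by blast
    qed
    then have "\<Lambda> = {0} \<or> \<Lambda> = UNIV" using 0 by blast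
    then show ?thesis using \<epsilon> by (auto simp: orthogonal_type_def symplectic_type_def)
  next
    case False
    then have 2: "(2 :: 'p mod_ring) \<noteq> 0" by (simp add: two_eq_0_iff_mod_ring)
    show ?thesis
    proof (cases "\<epsilon> = 1")
      case True
      have "a = 0" if "a \<in> \<Lambda>" for a
      proof -
        have "2 * a = 0" using max[OF that] True by (simp add: eq_neg_iff_add_eq_0)
        then show ?thesis using 2 by simp
      qed
      then have "\<Lambda> = {0}" using 0 by blast
      then show ?thesis using True by (simp add: orthogonal_type_def)
    next
      case False
      then have \<epsilon>: "\<epsilon> = - 1" using assms(2) by simp
      have "a \<in> \<Lambda>" for a using even[of "a / 2"] 2 by (simp add: \<epsilon>)
      then show ?thesis using \<epsilon> by (auto simp: symplectic_type_def)
    qed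
  qed
qed

section \<open>The trace of a finite field over its prime field\<close>

text \<open>Dedekind's argument: the relation at \<open>y * x\<close> minus \<open>\<rho> y\<close>
  times the relation at \<open>x\<close> no longer involves \<open>\<rho>\<close>. Choosing
  \<open>y\<close> with \<open>\<tau> y \<noteq> \<rho> y\<close> lets the induction hypothesis
  remove the coefficient of \<open>\<tau>\<close>.\<close>

lemma independence_of_characters:
  fixes c :: "('a::comm_monoid_mult \<Rightarrow> 'f::idom) \<Rightarrow> 'f"
  assumes "finite S"
    and "\<And>\<tau> x y. \<tau> \<in> S \<Longrightarrow> \<tau> (x * y) = \<tau> x * \<tau> y" "\<And>\<tau>. \<tau> \<in> S \<Longrightarrow> \<tau> 1 = 1"
    and "\<And>x. (\<Sum>\<tau>\<in>S. c \<tau> * \<tau> x) = 0"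
    and "\<tau> \<in> S"
  shows "c \<tau> = 0"
  using assms
proof (induction S arbitrary: c \<tau> rule: finite_induct)
  case (insert \<rho> S)
  have vanish: "c \<tau> = 0" if "\<tau> \<in> S" for \<tau>
  proof -
    have "\<tau> \<noteq> \<rho>" using that insert.hyps by auto
    then obtain y where y: "\<tau> y \<noteq> \<rho> y" by (meson ext)
    have "(\<Sum>\<tau>\<in>S. (c \<tau> * (\<tau> y - \<rho> y)) * \<tau> x) = 0" for x
    proof -
      have "(\<Sum>\<tau>\<in>insert \<rho> S. c \<tau> * \<tau> (y * x)) - \<rho> y * (\<Sum>\<tau>\<in>insert \<rho> S. c \<tau> * \<tau> x) = 0"
        by (simp only: insert.prems(3) mult_zero_right diff_zero)
      also have "(\<Sum>\<tau>\<in>insert \<rho> S. c \<tau> * \<tau> (y * x)) - \<rho> y * (\<Sum>\<tau>\<in>insert \<rho> S. c \<tau> * \<tau> x) =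
          (\<Sum>\<tau>\<in>insert \<rho> S. (c \<tau> * (\<tau> y - \<rho> y)) * \<tau> x)"
        unfolding sum_distrib_left sum_subtractf[symmetric]
        by (intro sum.cong refl) (simp add: insert.prems(1) algebra_simps)
      also have "\<dots> = (\<Sum>\<tau>\<in>S. (c \<tau> * (\<tau> y - \<rho> y)) * \<tau> x)"
        using insert.hyps by simp
      finally show ?thesis .
    qed
    then have "c \<tau> * (\<tau> y - \<rho> y) = 0"
      using insert.IH[of "\<lambda>\<tau>. c \<tau> * (\<tau> y - \<rho> y)" \<tau>] insert.prems(1,2) that by blast
    then show ?thesis using y by simp
  qed
  moreover have "c \<rho> = 0"
  proof -
    have "(\<Sum>\<tau>\<in>insert \<rho> S. c \<tau> * \<tau> 1) = c \<rho> * \<rho> 1"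
      using insert.hyps vanish by simp
    then show ?thesis using insert.prems(2)[of \<rho>] insert.prems(3)[of 1] by simp
  qed
  ultimately show ?case using insert.prems(4) by (metis insert_iff)
qed simp

text \<open>Each off-diagonal entry cancels against its mirror image.\<close>

lemma sum_symmetric_char_2:
  fixes M :: "nat \<Rightarrow> nat \<Rightarrow> 'a::comm_monoid_add"
  assumes "\<And>x :: 'a. x + x = 0" "\<And>i j. M i j = M j i"
  shows "(\<Sum>i<n. \<Sum>j<n. M i j) = (\<Sum>i<n. M i i)"
proof (induction n)
  case (Suc n)
  have "(\<Sum>i<Suc n. \<Sum>j<Suc n. M i j) =
      (\<Sum>i<n. \<Sum>j<n. M i j) + ((\<Sum>i<n. M i n) + (\<Sum>i<n. M n i)) + M n n"
    by (simp add: sum.distrib ac_simps)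
  also have "(\<Sum>i<n. M n i) = (\<Sum>i<n. M i n)" by (simp add: assms(2)[of n])
  finally show ?case by (simp add: assms(1) Suc.IH)
qed simp

text \<open>Unspecified unless \<open>g\<close> is additive in its first argument.\<close>

definition trace_lift ::
  "('k::finite_field \<Rightarrow> 'v \<Rightarrow> 'v) \<Rightarrow> ('v \<Rightarrow> 'v \<Rightarrow> 'p::prime_card mod_ring) \<Rightarrow> 'v \<Rightarrow> 'v \<Rightarrow> 'k" where
  "trace_lift smul g x y = (THE c. \<forall>a. prime_trace (a * c) = g (smul a x) y)"

context
  assumes char: "CHAR('k::finite_field) = CARD('p::prime_card)"
begin

private abbreviation (input) incl :: "'p mod_ring \<Rightarrow> 'k" where "incl \<equiv> of_prime_field"
private abbreviation (input) tr :: "'k \<Rightarrow> 'p mod_ring" where "tr \<equiv> prime_trace"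

text \<open>The embedding is defined through representatives between 0 and p - 1. Independence of
  the representative, valid since p vanishes in \<open>k\<close>, turns its ring homomorphism laws
  into those of \<open>of_int\<close>.\<close>

lemma of_prime_field_of_int: "incl (of_int z) = of_int z"
proof -
  have "incl (of_int z) = of_int (z mod int CARD('p))"
    by (simp add: of_prime_field_def of_int_of_int_mod_ring to_int_mod_ring.rep_eq of_int_mod_ring.rep_eq)
  also have "\<dots> = of_int (z mod int CARD('p)) + of_nat CHAR('k) * of_int (z div int CARD('p))"
    by simp
  also have "\<dots> = of_int (z mod int CARD('p) + int CARD('p) * (z div int CARD('p)))"
    unfolding char by (simp only: of_int_add of_int_mult of_int_of_nat_eq)
  finally show ?thesis by (simp only: mod_mult_div_eq)
qed

lemma mod_ring_of_int_cases: obtains z where "(c::'p mod_ring) = of_int z"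
  by (metis of_int_mod_ring_to_int_mod_ring of_int_of_int_mod_ring)

lemma of_prime_field_0: "incl 0 = 0" and of_prime_field_1: "incl 1 = 1"
  using of_prime_field_of_int[of 0] of_prime_field_of_int[of 1] by simp_all

lemma of_prime_field_add: "incl (c + d) = incl c + incl d"
  by (rule mod_ring_of_int_cases[of c], rule mod_ring_of_int_cases[of d])
    (metis of_int_add of_prime_field_of_int)

lemma of_prime_field_mult: "incl (c * d) = incl c * incl d"
  by (rule mod_ring_of_int_cases[of c], rule mod_ring_of_int_cases[of d])
    (metis of_int_mult of_prime_field_of_int)

lemma of_prime_field_uminus: "incl (- c) = - incl c"
  by (rule mod_ring_of_int_cases[of c]) (metis of_int_minus of_prime_field_of_int)

lemma of_prime_field_eq_0_iff: "incl c = 0 \<longleftrightarrow> c = 0"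
proof
  assume *: "incl c = 0"
  show "c = 0"
  proof (rule ccontr)
    assume "c \<noteq> 0"
    then have "incl (c * inverse c) = 1" by (simp add: of_prime_field_1)
    then show False using * by (simp add: of_prime_field_mult)
  qed
qed (simp add: of_prime_field_0)

lemma of_prime_field_inj: "inj incl"
proof (rule injI)
  fix c d assume "incl c = incl d"
  then have "incl (c + - d) = 0"
    by (simp only: of_prime_field_add of_prime_field_uminus) simp
  then show "c = d" by (simp add: of_prime_field_eq_0_iff)
qed

text \<open>By Fermat the p elements of the range are roots of X^p - X, which has no further roots
  by its degree. The prime field is thereby the fixed field of Frobenius.\<close>

lemma range_of_prime_field: "range incl = {x. x ^ CARD('p) = x}"
proof (rule card_subset_eq)
  let ?f = "Polynomial.monom 1 CARD('p) - Polynomial.monom 1 1 :: 'k poly"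
  have p: "1 < CARD('p)" using prime_card prime_gt_1_nat by blast
  have roots: "{x. x ^ CARD('p) = x} = {x. poly ?f x = 0}"
    by (simp add: poly_monom)
  have "Polynomial.coeff ?f CARD('p) = 1" using p by simp
  then have f: "?f \<noteq> 0" by (metis coeff_0 zero_neq_one)
  show "range incl \<subseteq> {x. x ^ CARD('p) = x}"
  proof clarify
    fix c
    have pow: "incl c ^ n = incl (c ^ n)" for n
      by (induction n) (simp_all add: of_prime_field_1 of_prime_field_mult)
    have "c ^ CARD('p) = c" using finite_field_power_card_eq_same[of c] by simp
    then show "incl c ^ CARD('p) = incl c" by (simp add: pow)
  qed
  then have "card (range incl) \<le> card {x :: 'k. x ^ CARD('p) = x}"
    by (intro card_mono) auto
  moreover have "card {x :: 'k. x ^ CARD('p) = x} \<le> CARD('p)"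
  proof -
    have "Polynomial.degree ?f \<le> CARD('p)"
      using p by (intro degree_diff_le) (auto simp: degree_monom_eq)
    then show ?thesis unfolding roots using card_poly_roots_bound[OF f] by linarith
  qed
  moreover have "card (range incl) = CARD('p)"
    using card_image[OF of_prime_field_inj] by simp
  ultimately show "card (range incl) = card {x :: 'k. x ^ CARD('p) = x}" by simp
qed simp

lemma field_isom_frobenius: "field_isom (\<lambda>x::'k. x ^ CARD('p))"
proof -
  have hom: "field_hom (\<lambda>x::'k. x ^ CARD('p))"
  proof
    fix x y :: 'k
    show "(x + y) ^ CARD('p) = x ^ CARD('p) + y ^ CARD('p)"
      by (rule freshmans_dream) (use prime_card[where 'a = 'p] char in auto)
  qed (auto simp: power_mult_distrib zero_power)
  then interpret field_hom "\<lambda>x::'k. x ^ CARD('p)" .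
  have "surj (\<lambda>x::'k. x ^ CARD('p))"
    by (intro finite_UNIV_inj_surj) (simp_all add: injectivity inj_on_def)
  then show ?thesis
    using hom by (simp add: field_isom_def surjective_def)
qed

lemma field_isom_simps:
  assumes "field_isom (\<tau> :: 'k \<Rightarrow> 'k)"
  shows "\<tau> (x + y) = \<tau> x + \<tau> y" "\<tau> (x * y) = \<tau> x * \<tau> y" "\<tau> 1 = 1" "\<tau> (of_int z) = of_int z"
    "\<tau> (sum f A) = (\<Sum>x\<in>A. \<tau> (f x))" "surj \<tau>" "inj \<tau>"
proof -
  interpret \<tau>: field_isom \<tau> by fact
  show "\<tau> (x + y) = \<tau> x + \<tau> y" "\<tau> (x * y) = \<tau> x * \<tau> y" "\<tau> 1 = 1" "surj \<tau>"
    by (simp_all add: \<tau>.hom_add \<tau>.hom_mult \<tau>.surj)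
  show "\<tau> (of_int z) = of_int z" by (rule \<tau>.hom_of_int)
  show "\<tau> (sum f A) = (\<Sum>x\<in>A. \<tau> (f x))" by (rule \<tau>.hom_sum)
  show "inj \<tau>" by (simp add: \<tau>.inj_f)
qed

lemma field_isomI:
  assumes "\<And>x y. \<tau> (x + y) = \<tau> x + \<tau> y" "\<And>x y. \<tau> (x * y) = \<tau> x * \<tau> y" "\<tau> 1 = 1" "surj \<tau>"
  shows "field_isom (\<tau> :: 'k \<Rightarrow> 'k)"
proof -
  have "\<tau> 0 = 0" using assms(1)[of 0 0] by (metis add_0 add_cancel_right_left)
  then show ?thesis using assms by unfold_locales auto
qed

lemma field_isom_comp: "field_isom \<sigma> \<Longrightarrow> field_isom \<tau> \<Longrightarrow> field_isom (\<lambda>x. \<sigma> (\<tau> x))"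
  for \<sigma> \<tau> :: "'k \<Rightarrow> 'k"
  using comp_surj[of \<tau> \<sigma>] by (intro field_isomI) (simp_all add: field_isom_simps o_def)

lemma field_isom_inv:
  assumes "field_isom (\<sigma> :: 'k \<Rightarrow> 'k)"
  shows "field_isom (inv_into UNIV \<sigma>)"
proof (rule field_isomI)
  have inv: "\<sigma> (inv_into UNIV \<sigma> x) = x" for x
    using field_isom_simps(6)[OF assms] by (rule surj_f_inv_f)
  show "inv_into UNIV \<sigma> (x + y) = inv_into UNIV \<sigma> x + inv_into UNIV \<sigma> y" for x y
    by (rule injD[OF field_isom_simps(7)[OF assms]]) (simp only: inv field_isom_simps[OF assms])
  show "inv_into UNIV \<sigma> (x * y) = inv_into UNIV \<sigma> x * inv_into UNIV \<sigma> y" for x y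
    by (rule injD[OF field_isom_simps(7)[OF assms]]) (simp only: inv field_isom_simps[OF assms])
  show "inv_into UNIV \<sigma> 1 = 1"
    by (rule injD[OF field_isom_simps(7)[OF assms]]) (simp only: inv field_isom_simps[OF assms])
  show "surj (inv_into UNIV \<sigma>)"
    using field_isom_simps(7)[OF assms] by (rule inj_imp_surj_inv)
qed

text \<open>Composition with \<open>\<sigma>\<close> on either side permutes the automorphisms. The
  first identity, for Frobenius, puts the sum into the prime field; the second makes the trace
  invariant under automorphisms.\<close>

lemma trace_sum_reindex:
  assumes "field_isom (\<sigma> :: 'k \<Rightarrow> 'k)"
  shows "(\<Sum>\<tau>\<in>{\<tau>. field_isom \<tau>}. \<sigma> (\<tau> a)) = (\<Sum>\<tau>\<in>{\<tau>. field_isom \<tau>}. \<tau> a)"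
    and "(\<Sum>\<tau>\<in>{\<tau> :: 'k \<Rightarrow> 'k. field_isom \<tau>}. \<tau> (\<sigma> a)) = (\<Sum>\<tau>\<in>{\<tau>. field_isom \<tau>}. \<tau> a)"
proof -
  have inv: "\<sigma> (inv_into UNIV \<sigma> x) = x" "inv_into UNIV \<sigma> (\<sigma> x) = x" for x
    using field_isom_simps(6,7)[OF assms] by (simp_all add: surj_f_inv_f)
  show "(\<Sum>\<tau>\<in>{\<tau>. field_isom \<tau>}. \<sigma> (\<tau> a)) = (\<Sum>\<tau>\<in>{\<tau>. field_isom \<tau>}. \<tau> a)"
    by (rule sum.reindex_bij_witness[of _ "\<lambda>\<tau> x. inv_into UNIV \<sigma> (\<tau> x)" "\<lambda>\<tau> x. \<sigma> (\<tau> x)"])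
      (use field_isom_comp[OF assms] field_isom_comp[OF field_isom_inv[OF assms]] in \<open>simp_all add: inv\<close>)
  show "(\<Sum>\<tau>\<in>{\<tau> :: 'k \<Rightarrow> 'k. field_isom \<tau>}. \<tau> (\<sigma> a)) = (\<Sum>\<tau>\<in>{\<tau>. field_isom \<tau>}. \<tau> a)"
    by (rule sum.reindex_bij_witness[of _ "\<lambda>\<tau> x. \<tau> (inv_into UNIV \<sigma> x)" "\<lambda>\<tau> x. \<tau> (\<sigma> x)"])
      (use field_isom_comp[OF _ assms] field_isom_comp[OF _ field_isom_inv[OF assms]] in \<open>simp_all add: inv\<close>)
qed

text \<open>Justifies the definite description in \<open>prime_trace\<close>: the sum of conjugates
  is fixed by Frobenius, hence lies in the range of the embedding, which is injective.\<close>

lemma of_prime_field_trace: "incl (tr a) = (\<Sum>\<tau>\<in>{\<tau>. field_isom \<tau>}. \<tau> a)"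
proof -
  let ?S = "\<Sum>\<tau>\<in>{\<tau> :: 'k \<Rightarrow> 'k. field_isom \<tau>}. \<tau> a"
  have "?S ^ CARD('p) = ?S"
    unfolding field_isom_simps(5)[OF field_isom_frobenius] trace_sum_reindex(1)[OF field_isom_frobenius] ..
  then obtain c where c: "incl c = ?S"
    using range_of_prime_field by (metis (mono_tags, lifting) imageE mem_Collect_eq)
  have "\<exists>!c. incl c = ?S"
    using c of_prime_field_inj by (metis injD)
  then show ?thesis unfolding prime_trace_def by (rule theI')
qed

lemma prime_trace_add: "tr (a + b) = tr a + tr b"
proof (rule injD[OF of_prime_field_inj])
  show "incl (tr (a + b)) = incl (tr a + tr b)"
    unfolding of_prime_field_add of_prime_field_trace sum.distrib[symmetric]
    by (intro sum.cong) (simp_all add: field_isom_simps)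
qed

lemma prime_trace_scale: "tr (incl c * a) = c * tr a"
proof (rule injD[OF of_prime_field_inj])
  show "incl (tr (incl c * a)) = incl (c * tr a)"
    unfolding of_prime_field_mult of_prime_field_trace sum_distrib_left
    by (intro sum.cong) (simp_all add: field_isom_simps of_prime_field_def)
qed

lemma prime_trace_scale_right: "tr (a * (incl c * b)) = c * tr (a * b)"
  using prime_trace_scale[of c "a * b"] by (simp only: mult.left_commute)

lemma prime_trace_isom: "field_isom \<sigma> \<Longrightarrow> tr (\<sigma> a) = tr a"
  by (rule injD[OF of_prime_field_inj]) (simp add: of_prime_field_trace trace_sum_reindex(2))

lemma prime_trace_0: "tr 0 = 0"
  using prime_trace_add[of 0 0] by (metis add_cancel_right_left add_0)

lemma prime_trace_uminus: "tr (- a) = - tr a"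
  using prime_trace_add[of a "- a"] by (simp add: prime_trace_0 eq_neg_iff_add_eq_0 add.commute)

lemma prime_trace_diff: "tr (a - b) = tr a - tr b"
  using prime_trace_add[of a "- b"] by (simp add: prime_trace_uminus)

lemma prime_trace_sum: "tr (sum f A) = (\<Sum>x\<in>A. tr (f x))"
  by (induction A rule: infinite_finite_induct) (simp_all add: prime_trace_0 prime_trace_add)

section \<open>Nondegeneracy of the trace form and dual bases\<close>

lemma independence_of_automorphisms:
  assumes "\<And>x. (\<Sum>\<tau>\<in>{\<tau>::'k \<Rightarrow> 'k. field_isom \<tau>}. c \<tau> * \<tau> x) = (0::'k)" and "field_isom \<tau>"
  shows "c \<tau> = 0"
proof (rule independence_of_characters[where S = "{\<tau>::'k \<Rightarrow> 'k. field_isom \<tau>}" and c = c and \<tau> = \<tau>])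
  show "(\<Sum>\<tau>\<in>{\<tau>::'k \<Rightarrow> 'k. field_isom \<tau>}. c \<tau> * \<tau> x) = 0" for x by (rule assms(1))
qed (simp_all add: assms(2) field_isom_simps)

lemma field_isom_id: "field_isom (\<lambda>x::'k. x)"
  by unfold_locales auto

text \<open>A vanishing trace would be a linear relation among the automorphisms with all
  coefficients 1. So some \<open>x\<close> has nonzero trace; it is rescaled to trace 1 and divided
  by \<open>a\<close>.\<close>

lemma prime_trace_dual:
  assumes "a \<noteq> 0"
  obtains b where "tr (a * b) = 1"
proof -
  have "\<exists>x. tr x \<noteq> 0"
  proof (rule ccontr)
    assume "\<not> ?thesis"
    then have "(\<Sum>\<tau>\<in>{\<tau>::'k \<Rightarrow> 'k. field_isom \<tau>}. 1 * \<tau> x) = 0" for x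
      using of_prime_field_trace[of x] by (simp add: of_prime_field_0)
    then have "(1::'k) = 0"
      by (rule independence_of_automorphisms[where c = "\<lambda>_. 1"]) (rule field_isom_id)
    then show False by simp
  qed
  then obtain x where x: "tr x \<noteq> 0" ..
  have "a * (incl (inverse (tr x)) * x / a) = incl (inverse (tr x)) * x"
    using assms by simp
  then have "tr (a * (incl (inverse (tr x)) * x / a)) = 1"
    using x by (simp only: prime_trace_scale) simp
  then show ?thesis using that by blast
qed

lemma prime_trace_eqI:
  assumes "\<And>b. tr (b * a) = tr (b * a')"
  shows "a = a'"
proof (rule ccontr)
  assume "a \<noteq> a'"
  then obtain b where "tr ((a - a') * b) = 1" using prime_trace_dual[of "a - a'"] by auto
  then show False using assms[of b] by (simp add: algebra_simps prime_trace_diff)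
qed

text \<open>A dual system of maximal length is a pair of dual bases for the trace form.\<close>

lemma trace_dual_bases:
  "\<exists>(n :: nat) (u :: nat \<Rightarrow> 'k) w.
     (\<forall>x. (\<Sum>i<n. incl (tr (x * w i)) * u i) = x) \<and> (\<forall>x. (\<Sum>i<n. incl (tr (x * u i)) * w i) = x)"
proof -
  define D :: "nat \<Rightarrow> (nat \<Rightarrow> 'k) \<Rightarrow> (nat \<Rightarrow> 'k) \<Rightarrow> bool"
    where "D n u w \<longleftrightarrow> (\<forall>i<n. \<forall>j<n. tr (u i * w j) = (if i = j then 1 else 0))" for n u w
  \<comment> \<open>Duality makes the \<open>u i\<close> distinct, so lengths are bounded by the
    size of \<open>k\<close> and a longest dual system exists.\<close>
  have bound: "n \<le> CARD('k)" if "D n u w" for n u w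
  proof -
    have "inj_on u {..<n}"
    proof (rule inj_onI)
      fix i j assume ij: "i \<in> {..<n}" "j \<in> {..<n}" "u i = u j"
      have "tr (u i * w j) = (if i = j then 1 else 0)" "tr (u j * w j) = (if j = j then 1 else 0)"
        using that ij(1,2) by (simp_all only: D_def lessThan_iff)
      then show "i = j" using ij(3) by (auto split: if_splits)
    qed
    then have "card {..<n} \<le> CARD('k)" by (metis card_image card_mono finite top_greatest)
    then show ?thesis by simp
  qed
  have "\<exists>u w. D 0 u w" by (simp add: D_def)
  then obtain n where n: "\<exists>u w. D n u w" and max: "\<And>m. \<exists>u w. D m u w \<Longrightarrow> m \<le> n"
  proof -
    assume *: "\<exists>u w. D 0 u w"
      and result: "\<And>n. \<exists>u w. D n u w \<Longrightarrow> (\<And>m. \<exists>u w. D m u w \<Longrightarrow> m \<le> n) \<Longrightarrow> thesis"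
    have bound': "m \<le> CARD('k)" if "\<exists>u w. D m u w" for m using that bound by blast
    show thesis
      using GreatestI_nat[of "\<lambda>n. \<exists>u w. D n u w", OF * bound']
        Greatest_le_nat[of "\<lambda>n. \<exists>u w. D n u w", OF _ bound'] by (rule result)
  qed
  then obtain u w where D: "D n u w" by blast
  have tr_u: "tr ((\<Sum>i<n. incl (c i) * u i) * w j) = c j" if "j < n" for c j
  proof -
    have "tr ((\<Sum>i<n. incl (c i) * u i) * w j) = (\<Sum>i<n. c i * tr (u i * w j))"
      by (simp add: sum_distrib_right prime_trace_sum mult.assoc prime_trace_scale)
    also have "\<dots> = (\<Sum>i<n. if i = j then c i else 0)"
      using D that by (intro sum.cong) (auto simp: D_def)
    finally show ?thesis using that by simp
  qed
  have tr_w: "tr (u j * (\<Sum>i<n. incl (c i) * w i)) = c j" if "j < n" for c j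
  proof -
    have "tr (u j * (\<Sum>i<n. incl (c i) * w i)) = (\<Sum>i<n. c i * tr (u j * w i))"
      by (simp add: sum_distrib_left prime_trace_sum prime_trace_scale_right)
    also have "\<dots> = (\<Sum>i<n. if i = j then c i else 0)"
      using D that by (intro sum.cong) (auto simp: D_def)
    finally show ?thesis using that by simp
  qed
  have expand: "x = (\<Sum>i<n. incl (tr (x * w i)) * u i)" for x
  proof (rule ccontr)
    \<comment> \<open>A nonzero remainder \<open>r\<close> has trace zero against every
      \<open>w j\<close>, and would extend the system by one more dual pair, against
      maximality.\<close>
    define r where "r = x - (\<Sum>i<n. incl (tr (x * w i)) * u i)"
    assume "x \<noteq> (\<Sum>i<n. incl (tr (x * w i)) * u i)"
    then have "r \<noteq> 0" by (simp add: r_def)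
    then obtain b where b: "tr (r * b) = 1" by (rule prime_trace_dual)
    have r: "tr (r * w j) = 0" if "j < n" for j
      using that tr_u[of j "\<lambda>i. tr (x * w i)"] by (simp add: r_def left_diff_distrib prime_trace_diff)
    \<comment> \<open>Removing the components of \<open>b\<close> along the \<open>w i\<close> gives
      zero trace against every \<open>u j\<close>. The trace against \<open>r\<close> stays 1
      because \<open>r\<close> pairs to zero with the \<open>w i\<close>.\<close>
    define t where "t = b - (\<Sum>i<n. incl (tr (u i * b)) * w i)"
    have "tr (u j * t) = 0" if "j < n" for j
      using that tr_w[of j "\<lambda>i. tr (u i * b)"] by (simp add: t_def right_diff_distrib prime_trace_diff)
    moreover have "tr (r * t) = 1"
      using r b by (simp add: t_def right_diff_distrib prime_trace_diff sum_distrib_left prime_trace_sum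
          prime_trace_scale_right)
    ultimately have "D (Suc n) (u(n := r)) (w(n := t))"
      using D r by (auto simp: D_def less_Suc_eq)
    then have "Suc n \<le> n" using max by blast
    then show False by simp
  qed
  \<comment> \<open>The second expansion follows from the first by testing it against an arbitrary
    \<open>b\<close>, itself expanded in the \<open>u i\<close>.\<close>
  have "x = (\<Sum>i<n. incl (tr (x * u i)) * w i)" for x
  proof (rule prime_trace_eqI)
    fix b
    have "tr (u j * (\<Sum>i<n. incl (tr (x * u i)) * w i)) = tr (u j * x)" if "j < n" for j
      using tr_w[OF that, of "\<lambda>i. tr (x * u i)"] by (simp add: mult.commute)
    then have "tr (b * (\<Sum>i<n. incl (tr (x * u i)) * w i)) = (\<Sum>j<n. tr (b * w j) * tr (u j * x))"
      by (subst expand[of b]) (simp add: sum_distrib_right prime_trace_sum mult.assoc prime_trace_scale)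
    also have "\<dots> = tr (b * x)"
      by (subst (2) expand[of b]) (simp add: sum_distrib_right prime_trace_sum mult.assoc prime_trace_scale)
    finally show "tr (b * x) = tr (b * (\<Sum>i<n. incl (tr (x * u i)) * w i))" ..
  qed
  then show ?thesis using expand[symmetric] by (intro exI conjI allI) (rule sym)
qed

lemmas trace_simps = prime_trace_0 prime_trace_add prime_trace_uminus
  prime_trace_diff prime_trace_sum prime_trace_scale
  prime_trace_scale_right

lemmas incl_simps = of_prime_field_0 of_prime_field_1 of_prime_field_add
  of_prime_field_mult of_prime_field_uminus

section \<open>Lifting forms along the trace\<close>

lemma vector_space_prime_smul:
  assumes "vector_space smul"
  shows "vector_space (prime_smul (smul :: 'k \<Rightarrow> 'v::ab_group_add \<Rightarrow> 'v) :: 'p mod_ring \<Rightarrow> 'v \<Rightarrow> 'v)"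
  by unfold_locales (simp_all add: prime_smul_def vector_spaceD[OF assms] incl_simps)

text \<open>Every element of F_p is a sum of ones. Hence additivity is all that the lemmas on
  functionals and biadditive maps below have to assume.\<close>

lemma additive_imp_prime_linear:
  fixes g :: "'v::ab_group_add \<Rightarrow> 'p mod_ring"
  assumes smul: "vector_space (smul :: 'k \<Rightarrow> 'v \<Rightarrow> 'v)" and add: "\<And>x y. g (x + y) = g x + g y"
  shows "g (smul (incl c) x) = c * g x"
proof -
  obtain i where c: "c = of_nat i" using surj_of_nat_mod_ring by blast
  have "g 0 = 0" using add[of 0 0] by (metis add_0 add_cancel_right_left)
  then have "g (smul (incl (of_nat i)) x) = of_nat i * g x"
    by (induction i) (simp_all add: incl_simps vector_spaceD[OF smul] add distrib_right)
  then show ?thesis by (simp add: c)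
qed

text \<open>The trace form identifies \<open>k\<close> with its dual over F_p; the values
  \<open>g (u i)\<close> are the coordinates of the representing element along the
  \<open>w i\<close>.\<close>

lemma additive_eq_trace:
  fixes g :: "'k \<Rightarrow> 'p mod_ring"
  assumes add: "\<And>x y. g (x + y) = g x + g y"
  shows "\<exists>!c. \<forall>a. tr (a * c) = g a"
proof -
  obtain n :: nat and u w :: "nat \<Rightarrow> 'k"
    where u: "\<forall>x. (\<Sum>i<n. incl (tr (x * w i)) * u i) = x"
    using trace_dual_bases by (elim exE conjE) (rule that)
  have g0: "g 0 = 0" using add[of 0 0] by (metis add_0 add_cancel_right_left)
  have g_sum: "g (\<Sum>i<m. f i) = (\<Sum>i<m. g (f i))" for m and f :: "nat \<Rightarrow> 'k"
    by (induction m) (simp_all add: g0 add)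
  have eq: "tr (a * (\<Sum>i<n. incl (g (u i)) * w i)) = g a" for a
  proof -
    have "tr (a * (\<Sum>i<n. incl (g (u i)) * w i)) = (\<Sum>i<n. g (u i) * tr (a * w i))"
      by (simp add: sum_distrib_left trace_simps)
    also have "\<dots> = g (\<Sum>i<n. incl (tr (a * w i)) * u i)"
      by (simp add: g_sum) (simp add: additive_imp_prime_linear[where g = g, OF vector_space_mult add] mult.commute[of "g _"])
    finally show ?thesis by (simp only: u)
  qed
  show ?thesis
  proof (rule ex1I)
    show "\<forall>a. tr (a * (\<Sum>i<n. incl (g (u i)) * w i)) = g a" by (intro allI eq)
    fix c assume "\<forall>a. tr (a * c) = g a"
    then show "c = (\<Sum>i<n. incl (g (u i)) * w i)"
      by (intro prime_trace_eqI) (simp only: eq)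
  qed
qed

lemma trace_lift:
  assumes smul: "vector_space (smul :: 'k \<Rightarrow> 'v::ab_group_add \<Rightarrow> 'v)"
    and add: "\<And>x x' y. (g :: 'v \<Rightarrow> 'v \<Rightarrow> 'p mod_ring) (x + x') y = g x y + g x' y"
  shows "tr (a * trace_lift smul g x y) = g (smul a x) y"
proof -
  have "\<exists>!c. \<forall>a. tr (a * c) = g (smul a x) y"
    by (rule additive_eq_trace) (simp add: vector_spaceD[OF smul] add)
  then have "\<forall>a. tr (a * trace_lift smul g x y) = g (smul a x) y"
    unfolding trace_lift_def by (rule theI')
  then show ?thesis ..
qed

text \<open>Each algebraic law is tested by multiplying with \<open>b\<close> and taking the trace,
  which moves \<open>b\<close> into the first argument of \<open>g\<close>. Semilinearity in the
  second argument is then the adjointness of \<open>g\<close>.\<close>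

lemma sesquilinear_trace_lift:
  fixes smul :: "'k \<Rightarrow> 'v::{topological_ab_group_add,t2_space} \<Rightarrow> 'v" and g :: "'v \<Rightarrow> 'v \<Rightarrow> 'p mod_ring"
  assumes V: "locally_compact_vector_space smul"
    and cont: "continuous_map euclidean (discrete_topology UNIV) (\<lambda>(x, y). g x y)"
    and add1: "\<And>x x' y. g (x + x') y = g x y + g x' y"
    and add2: "\<And>x y y'. g x (y + y') = g x y + g x y'"
    and inv: "\<And>a. \<sigma> (\<sigma> a) = a"
    and adj: "\<And>a x y. g (smul a x) y = g x (smul (\<sigma> a) y)"
  shows "sesquilinear_form smul \<sigma> (trace_lift smul g)"
proof -
  have smul: "vector_space smul" using V by (simp add: locally_compact_vector_space_def)
  note lift = trace_lift[where g = g, OF smul add1]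
  note eqI = prime_trace_eqI
  have "continuous_map euclidean (discrete_topology UNIV) (\<lambda>(x, y). trace_lift smul g x y)"
  \<comment> \<open>The lift at a pair depends only on the values \<open>g (smul a x) y\<close> for
    the finitely many scalars \<open>a\<close>.\<close>
  proof (rule continuous_map_discrete_factor[where A = UNIV])
    show "continuous_map euclidean (discrete_topology UNIV) (\<lambda>(x, y). g (smul a x) y)" for a
      using continuous_map_form_smul[OF cont V, of a 1] by (simp add: vector_spaceD[OF smul])
    fix z z' :: "'v \<times> 'v"
    assume "\<And>a. a \<in> UNIV \<Longrightarrow> (\<lambda>(x, y). g (smul a x) y) z = (\<lambda>(x, y). g (smul a x) y) z'"
    then show "(\<lambda>(x, y). trace_lift smul g x y) z = (\<lambda>(x, y). trace_lift smul g x y) z'"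
      by (auto simp: trace_lift_def split: prod.splits)
  qed simp
  moreover have "trace_lift smul g (x + x') y = trace_lift smul g x y + trace_lift smul g x' y" for x x' y
    by (rule eqI) (simp add: distrib_left trace_simps lift add1 vector_spaceD[OF smul])
  moreover have "trace_lift smul g x (y + y') = trace_lift smul g x y + trace_lift smul g x y'" for x y y'
    by (rule eqI) (simp add: distrib_left trace_simps lift add2)
  moreover have "trace_lift smul g (smul a x) y = a * trace_lift smul g x y" for a x y
    by (rule eqI) (simp add: lift vector_spaceD[OF smul] flip: mult.assoc)
  moreover have "trace_lift smul g x (smul a y) = \<sigma> a * trace_lift smul g x y" for a x y
  proof (rule eqI)
    fix b
    have "tr (b * trace_lift smul g x (smul a y)) = g (smul (\<sigma> a) (smul b x)) y"
      by (simp add: lift adj[of "\<sigma> a"] inv)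
    also have "\<dots> = tr (b * (\<sigma> a * trace_lift smul g x y))"
      using lift[of "\<sigma> a * b" x y] by (simp add: vector_spaceD[OF smul] mult_ac)
    finally show "tr (b * trace_lift smul g x (smul a y)) = tr (b * (\<sigma> a * trace_lift smul g x y))" .
  qed
  ultimately show ?thesis by (simp add: sesquilinear_form_def)
qed

lemma nondegenerate_trace_form:
  fixes smul :: "'k \<Rightarrow> 'v::{topological_ab_group_add,t2_space} \<Rightarrow> 'v" and h :: "'v \<Rightarrow> 'v \<Rightarrow> 'p mod_ring"
  assumes V: "locally_compact_vector_space smul"
    and h': "sesquilinear_form smul \<sigma> h'"
    and tr_h': "trace_form_eq h' h"
    and h: "nondegenerate_form (prime_smul smul :: 'p mod_ring \<Rightarrow> _) h"
  shows "nondegenerate_form smul h'"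
proof -
  let ?smul = "prime_smul smul :: 'p mod_ring \<Rightarrow> 'v \<Rightarrow> 'v"
  have smul: "vector_space smul" using V by (simp add: locally_compact_vector_space_def)
  define T :: "('v \<Rightarrow> 'k) \<Rightarrow> 'v \<Rightarrow> 'p mod_ring" where "T = (\<lambda>f x. tr (f x))"
  have TH: "T (\<lambda>x. h' x y) = (\<lambda>x. h x y)" for y
    using tr_h' by (simp add: T_def trace_form_eq_def)
  obtain K where K: "homeomorphic_maps euclidean (dual_topology ?smul) (\<lambda>y x. h x y) K"
    using h by (auto simp: nondegenerate_form_def homeomorphic_map_maps)
  have T_dual: "T f \<in> dual_space ?smul" if "f \<in> dual_space smul" for f
  proof -
    have f: "\<And>x y. f (x + y) = f x + f y" "\<And>c x. f (smul c x) = c * f x"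
      "continuous_map euclidean (discrete_topology UNIV) f"
      using that by (auto simp: dual_space_def linear_iff_vector_spaces)
    have "continuous_map euclidean (discrete_topology UNIV) (tr \<circ> f)"
      by (rule continuous_map_compose[OF f(3)]) simp
    then show ?thesis
      by (simp add: dual_space_def linear_iff_vector_spaces vector_space_prime_smul[OF smul] vector_space_mult
          T_def f o_def trace_simps prime_smul_def)
  qed
  \<comment> \<open>By k-linearity, equality of tr(f(ax)) and tr(f'(ax)) says that a f(x) and a
    f'(x) have equal traces for every \<open>a\<close>.\<close>
  have T_inj: "f = f'" if "f \<in> dual_space smul" "f' \<in> dual_space smul" "T f = T f'" for f f'
  proof
    fix x
    have "f (smul a x) = a * f x" "f' (smul a x) = a * f' x" for a
      using that(1,2) by (auto simp: dual_space_def linear_iff_vector_spaces)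
    then show "f x = f' x"
      using that(3) by (intro prime_trace_eqI) (metis T_def)
  qed
  have T_cont: "continuous_map (dual_topology smul) (dual_topology ?smul) T"
  proof (rule continuous_map_into_dual_topology)
    show "T f \<in> dual_space ?smul" if "f \<in> topspace (dual_topology smul)" for f
      using that T_dual by (simp add: topspace_dual_topology)
    fix C :: "'v set" and U assume "compact C"
    then have "openin (dual_topology smul) {f \<in> dual_space smul. f ` C \<subseteq> tr -` U}"
      by (rule openin_dual_topology_subbasis)
    also have "{f \<in> dual_space smul. f ` C \<subseteq> tr -` U} = {f \<in> topspace (dual_topology smul). T f ` C \<subseteq> U}"
      by (auto simp: topspace_dual_topology T_def)
    finally show "openin (dual_topology smul) {f \<in> topspace (dual_topology smul). T f ` C \<subseteq> U}" .
  qed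
  \<comment> \<open>If \<open>y\<close> represents \<open>T f\<close> through \<open>h\<close>, then
    h'(-,y) and \<open>f\<close> have the same image under \<open>T\<close>, so \<open>y\<close>
    represents \<open>f\<close> through \<open>h'\<close>. The inverse is thus a composite of
    continuous maps.\<close>
  have "homeomorphic_maps euclidean (dual_topology smul) (\<lambda>y x. h' x y) (K \<circ> T)"
    unfolding homeomorphic_maps_def
  proof (intro conjI ballI)
    show "continuous_map euclidean (dual_topology smul) (\<lambda>y x. h' x y)"
      by (rule continuous_map_form_slice[OF h' smul])
    show "continuous_map (dual_topology smul) euclidean (K \<circ> T)"
      using T_cont K by (auto simp: homeomorphic_maps_def intro: continuous_map_compose)
    show "(K \<circ> T) (\<lambda>x. h' x y) = y" for y
      using K by (simp add: TH homeomorphic_maps_def)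
    fix f assume "f \<in> topspace (dual_topology smul)"
    then have f: "f \<in> dual_space smul" by (simp add: topspace_dual_topology)
    then have "(\<lambda>x. h x (K (T f))) = T f"
      using K T_dual by (simp add: homeomorphic_maps_def topspace_dual_topology)
    then show "(\<lambda>x. h' x ((K \<circ> T) f)) = f"
      using f by (intro T_inj) (simp_all add: TH sesquilinear_form_slice[OF h' smul])
  qed
  then show ?thesis by (auto simp: nondegenerate_form_def homeomorphic_map_maps)
qed

section \<open>Sums of biadditive maps over dual bases\<close>

lemma biadditive_sum:
  fixes \<beta> :: "'k \<Rightarrow> 'k \<Rightarrow> 'p mod_ring" and n :: nat
  assumes "\<And>x x' y. \<beta> (x + x') y = \<beta> x y + \<beta> x' y" "\<And>x y y'. \<beta> x (y + y') = \<beta> x y + \<beta> x y'"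
  shows "\<beta> (\<Sum>i<n. incl (c i) * f i) y = (\<Sum>i<n. c i * \<beta> (f i) y)"
    and "\<beta> y (\<Sum>i<n. incl (c i) * f i) = (\<Sum>i<n. c i * \<beta> y (f i))"
proof -
  have "\<beta> 0 y = 0" using assms(1)[of 0 0 y] by (metis add_0 add_cancel_right_left)
  then show "\<beta> (\<Sum>i<n. incl (c i) * f i) y = (\<Sum>i<n. c i * \<beta> (f i) y)"
    by (induction n) (simp_all add: assms(1)
      additive_imp_prime_linear[where g = "\<lambda>x. \<beta> x y", OF vector_space_mult assms(1)])
  have "\<beta> y 0 = 0" using assms(2)[of y 0 0] by (metis add_0 add_cancel_right_left)
  then show "\<beta> y (\<Sum>i<n. incl (c i) * f i) = (\<Sum>i<n. c i * \<beta> y (f i))"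
    by (induction n) (simp_all add: assms(2)
      additive_imp_prime_linear[where g = "\<beta> y", OF vector_space_mult assms(2)])
qed

context
  fixes n :: nat and u w :: "nat \<Rightarrow> 'k"
  assumes u: "\<And>x. (\<Sum>i<n. incl (tr (x * w i)) * u i) = x"
    and w: "\<And>x. (\<Sum>i<n. incl (tr (x * u i)) * w i) = x"
begin

text \<open>Writing the trace in x = sum_i tr(x w_i) u_i as a sum over automorphisms expresses x as
  sum_\<tau> (sum_i u_i \<tau>(w_i)) \<tau>(x). By independence the coefficient of the identity must
  be 1.\<close>

lemma dual_bases_sum_mult: "(\<Sum>i<n. u i * w i) = 1"
proof -
  let ?A = "{\<tau> :: 'k \<Rightarrow> 'k. field_isom \<tau>}"
  define c where "c \<tau> = (\<Sum>i<n. u i * \<tau> (w i)) - (if \<tau> = (\<lambda>x. x) then 1 else 0)" for \<tau> :: "'k \<Rightarrow> 'k"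
  have "c (\<lambda>x. x) = 0"
  proof (rule independence_of_automorphisms[where c = c])
    show "field_isom (\<lambda>x::'k. x)" by (rule field_isom_id)
    fix x
    have "(\<Sum>\<tau>\<in>?A. (\<Sum>i<n. u i * \<tau> (w i)) * \<tau> x) = (\<Sum>\<tau>\<in>?A. \<Sum>i<n. \<tau> (x * w i) * u i)"
      unfolding sum_distrib_right
      by (intro sum.cong refl) (simp add: field_isom_simps mult_ac)
    also have "\<dots> = (\<Sum>i<n. (\<Sum>\<tau>\<in>?A. \<tau> (x * w i)) * u i)"
      unfolding sum_distrib_right by (rule sum.swap)
    also have "\<dots> = x"
      by (simp only: of_prime_field_trace[symmetric] u)
    finally have 1: "(\<Sum>\<tau>\<in>?A. (\<Sum>i<n. u i * \<tau> (w i)) * \<tau> x) = x" .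
    have "(\<Sum>\<tau>\<in>?A. (if \<tau> = (\<lambda>x. x) then 1 else 0) * \<tau> x) = (\<Sum>\<tau>\<in>?A. if \<tau> = (\<lambda>x. x) then \<tau> x else 0)"
      by (intro sum.cong) auto
    also have "\<dots> = x"
      using field_isom_id by simp
    finally show "(\<Sum>\<tau>\<in>?A. c \<tau> * \<tau> x) = 0"
      by (simp only: c_def left_diff_distrib sum_subtractf 1 diff_self)
  qed
  then show ?thesis by (simp add: c_def)
qed

context
  fixes \<beta> :: "'k \<Rightarrow> 'k \<Rightarrow> 'p mod_ring"
  assumes add: "\<And>x x' y. \<beta> (x + x') y = \<beta> x y + \<beta> x' y" "\<And>x y y'. \<beta> x (y + y') = \<beta> x y + \<beta> x y'"
begin

lemma dual_bases_expand:
  "\<beta> x y = (\<Sum>j<n. tr (x * w j) * \<beta> (u j) y)" "\<beta> y x = (\<Sum>j<n. tr (x * w j) * \<beta> y (u j))"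
  "\<beta> x y = (\<Sum>j<n. tr (x * u j) * \<beta> (w j) y)" "\<beta> y x = (\<Sum>j<n. tr (x * u j) * \<beta> y (w j))"
proof -
  show "\<beta> x y = (\<Sum>j<n. tr (x * w j) * \<beta> (u j) y)"
    using biadditive_sum(1)[of \<beta>, OF add, where c = "\<lambda>j. tr (x * w j)" and f = u and n = n and y = y] by (simp only: u)
  show "\<beta> y x = (\<Sum>j<n. tr (x * w j) * \<beta> y (u j))"
    using biadditive_sum(2)[of \<beta>, OF add, where c = "\<lambda>j. tr (x * w j)" and f = u and n = n and y = y] by (simp only: u)
  show "\<beta> x y = (\<Sum>j<n. tr (x * u j) * \<beta> (w j) y)"
    using biadditive_sum(1)[of \<beta>, OF add, where c = "\<lambda>j. tr (x * u j)" and f = w and n = n and y = y] by (simp only: w)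
  show "\<beta> y x = (\<Sum>j<n. tr (x * u j) * \<beta> y (w j))"
    using biadditive_sum(2)[of \<beta>, OF add, where c = "\<lambda>j. tr (x * u j)" and f = w and n = n and y = y] by (simp only: w)
qed

text \<open>Expanding u_i a along the \<open>u j\<close>, or w_j a along the \<open>w i\<close>,
  produces the same matrix of coefficients tr(u_i a w_j).\<close>

lemma dual_bases_balanced: "(\<Sum>i<n. \<beta> (u i * a) (w i)) = (\<Sum>i<n. \<beta> (u i) (w i * a))"
proof -
  have "(\<Sum>i<n. \<beta> (u i * a) (w i)) = (\<Sum>i<n. \<Sum>j<n. tr (u i * a * w j) * \<beta> (u j) (w i))"
    by (intro sum.cong refl dual_bases_expand(1))
  also have "\<dots> = (\<Sum>j<n. \<Sum>i<n. tr (w j * a * u i) * \<beta> (u j) (w i))"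
    by (subst sum.swap) (simp add: mult_ac)
  also have "\<dots> = (\<Sum>j<n. \<beta> (u j) (w j * a))"
    by (intro sum.cong refl dual_bases_expand(4)[symmetric])
  finally show ?thesis .
qed

text \<open>The coefficients of the \<open>u i\<close> along the \<open>w j\<close> form the
  symmetric matrix tr(u_i u_j).\<close>

lemma dual_bases_swap: "(\<Sum>i<n. \<beta> (u i) (w i)) = (\<Sum>i<n. \<beta> (w i) (u i))"
proof -
  have "(\<Sum>i<n. \<beta> (u i) (w i)) = (\<Sum>i<n. \<Sum>j<n. tr (u i * u j) * \<beta> (w j) (w i))"
    by (intro sum.cong refl dual_bases_expand(3))
  also have "\<dots> = (\<Sum>j<n. \<Sum>i<n. tr (u j * u i) * \<beta> (w j) (w i))"
    by (subst sum.swap) (simp add: mult.commute)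
  also have "\<dots> = (\<Sum>j<n. \<beta> (w j) (u j))"
    by (intro sum.cong refl dual_bases_expand(4)[symmetric])
  finally show ?thesis .
qed

text \<open>After expanding the \<open>w i\<close> along the \<open>u j\<close>, symmetry leaves
  only the diagonal terms tr(w_i^2) \<beta>(u_i,u_i). Frobenius invariance and squaring in F_2 give
  tr(w_i^2) = tr(w_i)^2, and the same cancellation read backwards produces \<beta>(1,1), since 1 =
  sum_i tr(w_i) u_i.\<close>

lemma dual_bases_symmetric_char_2:
  assumes p: "CARD('p) = 2" and sym: "\<And>x y. \<beta> x y = \<beta> y x"
  shows "(\<Sum>i<n. \<beta> (u i) (w i)) = \<beta> 1 1"
proof -
  have "(2 :: 'p mod_ring) = 0" using p by (simp add: two_eq_0_iff_mod_ring)
  then have twice: "x + x = 0" for x :: "'p mod_ring" by (simp flip: mult_2)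
  have "(\<Sum>i<n. \<beta> (u i) (w i)) = (\<Sum>i<n. \<Sum>j<n. tr (w i * w j) * \<beta> (u i) (u j))"
    by (intro sum.cong refl dual_bases_expand(2))
  also have "\<dots> = (\<Sum>i<n. tr (w i * w i) * \<beta> (u i) (u i))"
  proof (rule sum_symmetric_char_2[OF twice])
    show "tr (w i * w j) * \<beta> (u i) (u j) = tr (w j * w i) * \<beta> (u j) (u i)" for i j
      by (simp only: sym[of "u i" "u j"] mult.commute[of "w i"])
  qed
  also have "\<dots> = (\<Sum>i<n. (tr (w i) * tr (w i)) * \<beta> (u i) (u i))"
  proof (intro sum.cong refl)
    fix i
    have "tr (w i * w i) = tr (w i)"
      using prime_trace_isom[OF field_isom_frobenius, of "w i"] by (simp add: p power2_eq_square)
    also have "\<dots> = tr (w i) * tr (w i)"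
      using finite_field_power_card_eq_same[of "tr (w i)"] by (simp add: p power2_eq_square)
    finally show "tr (w i * w i) * \<beta> (u i) (u i) = (tr (w i) * tr (w i)) * \<beta> (u i) (u i)" by simp
  qed
  also have "\<dots> = (\<Sum>i<n. \<Sum>j<n. (tr (w i) * tr (w j)) * \<beta> (u i) (u j))"
  proof (rule sum_symmetric_char_2[OF twice, symmetric])
    show "(tr (w i) * tr (w j)) * \<beta> (u i) (u j) = (tr (w j) * tr (w i)) * \<beta> (u j) (u i)" for i j
      by (simp only: sym[of "u i" "u j"] mult.commute[of "tr (w i)"])
  qed
  also have "\<dots> = (\<Sum>i<n. tr (1 * w i) * (\<Sum>j<n. tr (1 * w j) * \<beta> (u i) (u j)))"
    by (simp add: sum_distrib_left mult.assoc)
  also have "\<dots> = (\<Sum>i<n. tr (1 * w i) * \<beta> (u i) 1)"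
    by (simp only: dual_bases_expand(2)[of _ 1, symmetric])
  also have "\<dots> = \<beta> 1 1"
    by (rule dual_bases_expand(1)[symmetric])
  finally show ?thesis .
qed

end

end

section \<open>Recovering elements and forms from their traces\<close>

lemma two_eq_0_iff_prime_field: "(2 :: 'k) = 0 \<longleftrightarrow> CARD('p) = 2"
proof -
  have "incl 2 = 2" using of_prime_field_of_int[of 2] by simp
  then show ?thesis using of_prime_field_eq_0_iff[of 2] by (simp add: two_eq_0_iff_mod_ring)
qed

lemma square_in_char_2:
  assumes "CARD('p) = 2"
  obtains a :: 'k where "a * a = b"
proof -
  obtain a where "b = a ^ CARD('p)"
    using field_isom_simps(6)[OF field_isom_frobenius] by (rule surjE)
  then show ?thesis using that[of a] assms by (simp add: power2_eq_square)
qed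

text \<open>The values of quadratic maps scale by squares, and in characteristic 2 every element of the field is one.\<close>

lemma trace_square_eqI:
  fixes a b :: 'k
  assumes double: "a + a = b + b" and trace: "\<And>c. tr (c * c * a) = tr (c * c * b)"
  shows "a = b"
proof (cases "CARD('p) = 2")
  case True
  have "tr (d * a) = tr (d * b)" for d
    using square_in_char_2[OF True, of d] trace by metis
  then show ?thesis by (rule prime_trace_eqI)
next
  case False
  then have "(2::'k) \<noteq> 0" by (simp add: two_eq_0_iff_prime_field)
  then show ?thesis using double by (simp flip: mult_2)
qed

lemma trace_form_unique:
  fixes h1 h2 :: "'v::{topological_ab_group_add,t2_space} \<Rightarrow> 'v \<Rightarrow> 'k" and h :: "'v \<Rightarrow> 'v \<Rightarrow> 'p mod_ring"
  assumes "sesquilinear_form smul \<sigma>1 h1" "trace_form_eq h1 h" "sesquilinear_form smul \<sigma>2 h2" "trace_form_eq h2 h"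
  shows "h1 = h2"
proof (intro ext prime_trace_eqI)
  fix x y b
  have "tr (b * h1 x y) = h (smul b x) y"
    using assms(2) by (simp add: trace_form_eq_def flip: sesquilinear_formD(4)[OF assms(1)])
  also have "\<dots> = tr (b * h2 x y)"
    using assms(4) by (simp add: trace_form_eq_def flip: sesquilinear_formD(4)[OF assms(3)])
  finally show "tr (b * h1 x y) = tr (b * h2 x y)" .
qed

context
  fixes \<sigma> :: "'k \<Rightarrow> 'k"
    and smul :: "'k \<Rightarrow> 'v::{topological_ab_group_add,t2_space} \<Rightarrow> 'v"
    and \<epsilon> :: "'p mod_ring" and \<Lambda> :: "'p mod_ring set" and h :: "'v \<Rightarrow> 'v \<Rightarrow> 'p mod_ring"
    and q :: "'v \<Rightarrow> 'p mod_ring set"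
  assumes \<sigma>: "field_involution \<sigma>"
    and V: "locally_compact_vector_space smul"
    and space: "nondegenerate_quadratic_space (prime_smul smul) id \<epsilon> \<Lambda> h q"
    and adjoint: "\<forall>a x y. h (smul a x) y = h x (smul (\<sigma> a) y)"
begin

private lemma smul: "vector_space smul"
  using V by (simp add: locally_compact_vector_space_def)

private lemma quadratic: "quadratic_space (prime_smul smul) id \<epsilon> \<Lambda> h q"
  and nondegenerate: "nondegenerate_form (prime_smul smul) h"
  using space by (simp_all add: nondegenerate_quadratic_space_def)

private lemma space_type: "orthogonal_type id \<epsilon> \<Lambda> \<or> symplectic_type id \<epsilon> \<Lambda>"
  using quadratic by (intro prime_field_form_type) (simp_all add: quadratic_space_def)

private lemma form_sesquilinear: "sesquilinear_form (prime_smul smul) id h"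
  by (rule quadratic_space_sesquilinear[OF quadratic field_involution_id])

private lemma sign_prime_field: "incl \<epsilon> = 1 \<or> incl \<epsilon> = - 1"
  using quadratic_space_sign[OF quadratic]
  by (auto simp: of_prime_field_1 of_prime_field_uminus)

section \<open>Nontrivial involution: the unitary space\<close>

lemma unitary_space_exists:
  assumes "\<sigma> \<noteq> id"
  shows "\<exists>\<Lambda>' h' q'. unitary_space smul \<sigma> (incl \<epsilon>) \<Lambda>' h' q' \<and> trace_form_eq h' h"
proof -
  define h' where "h' = trace_lift smul h"
  define \<Lambda>' where "\<Lambda>' = {a. a = - incl \<epsilon> * \<sigma> a}"
  obtain \<theta> where \<theta>: "\<theta> + \<sigma> \<theta> = 1" using nontrivial_involution_trace_1[OF \<sigma> assms] .
  \<comment> \<open>As \<open>h'\<close> is hermitian of sign \<epsilon>, this polarises to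
    (\<theta> + \<sigma>(\<theta>)) h' = h'.\<close>
  define s' where "s' x y = \<theta> * h' x y" for x y
  have lift: "tr (a * h' x y) = h (smul a x) y" for a x y
    unfolding h'_def by (rule trace_lift[OF smul]) (rule sesquilinear_formD(2)[OF form_sesquilinear])
  have h': "sesquilinear_form smul \<sigma> h'"
    unfolding h'_def
    by (rule sesquilinear_trace_lift[OF V])
      (use sesquilinear_formD[OF form_sesquilinear] adjoint field_involutionD[OF \<sigma>] in simp_all)
  have tr_h': "trace_form_eq h' h"
    using lift[of 1] by (simp add: trace_form_eq_def vector_spaceD[OF smul])
  \<comment> \<open>Combines the invariance of the trace under \<open>\<sigma>\<close>, the
    adjointness of \<open>h\<close> and its symmetry of sign \<open>\<epsilon>\<close>.\<close>
  have herm: "h' x y = incl \<epsilon> * \<sigma> (h' y x)" for x y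
  proof (rule prime_trace_eqI)
    fix b
    have "tr (b * (incl \<epsilon> * \<sigma> (h' y x))) = \<epsilon> * tr (\<sigma> (\<sigma> b * h' y x))"
      by (simp add: prime_trace_scale_right field_involutionD[OF \<sigma>])
    also have "\<dots> = \<epsilon> * h (smul (\<sigma> b) y) x"
      by (simp add: prime_trace_isom[OF field_involution_isom[OF \<sigma>]] lift)
    also have "\<dots> = \<epsilon> * h y (smul b x)"
      using adjoint by (simp add: field_involutionD[OF \<sigma>])
    also have "\<dots> = h (smul b x) y"
      using quadratic_space_hermitian[OF quadratic field_involution_id, of "smul b x" y] by simp
    finally show "tr (b * h' x y) = tr (b * (incl \<epsilon> * \<sigma> (h' y x)))" by (simp add: lift)
  qed
  \<comment> \<open>A single map suffices for the factorisation: \<open>s' x y\<close> is a function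
    of \<open>h' x y\<close>.\<close>
  have cont: "continuous_map euclidean (discrete_topology UNIV) (\<lambda>(x, y). s' x y)"
    by (rule continuous_map_discrete_factor[where A = "{()}" and f = "\<lambda>_ (x, y). h' x y"])
      (use sesquilinear_formD(1)[OF h'] in \<open>auto simp: s'_def\<close>)
  have s': "sesquilinear_form smul \<sigma> s'"
    using cont by (simp add: sesquilinear_form_def s'_def sesquilinear_formD[OF h'] algebra_simps)
  have "h' x y = s' x y + incl \<epsilon> * \<sigma> (s' y x)" for x y
  proof -
    have "s' x y + incl \<epsilon> * \<sigma> (s' y x) = \<theta> * h' x y + \<sigma> \<theta> * (incl \<epsilon> * \<sigma> (h' y x))"
      by (simp add: s'_def field_involutionD[OF \<sigma>] mult_ac)
    also have "\<dots> = (\<theta> + \<sigma> \<theta>) * h' x y" by (simp only: herm[symmetric] distrib_right)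
    finally show ?thesis by (simp add: \<theta>)
  qed
  then have "h' = (\<lambda>x y. s' x y + incl \<epsilon> * adjoint_form \<sigma> s' x y)"
    by (simp add: adjoint_form_def fun_eq_iff)
  moreover have "form_parameter \<sigma> (incl \<epsilon>) \<Lambda>'"
    using form_parameter_nontrivial_involution[OF \<sigma> assms sign_prime_field] by (simp add: \<Lambda>'_def)
  ultimately have "quadratic_space smul \<sigma> (incl \<epsilon>) \<Lambda>' h' (\<lambda>v. s' v v +o \<Lambda>')"
    using sign_prime_field s' unfolding quadratic_space_def by blast
  then have "unitary_space smul \<sigma> (incl \<epsilon>) \<Lambda>' h' (\<lambda>v. s' v v +o \<Lambda>')"
    using assms nondegenerate_trace_form[OF V h' tr_h' nondegenerate]
    by (simp add: unitary_space_def nondegenerate_quadratic_space_def)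
  then show ?thesis using tr_h' by blast
qed

lemma unitary_space_unique:
  assumes "unitary_space smul \<sigma> \<epsilon>' \<Lambda>1 h1 q1" "trace_form_eq h1 h"
    and "unitary_space smul \<sigma> \<epsilon>' \<Lambda>2 h2 q2" "trace_form_eq h2 h"
  shows "\<Lambda>1 = \<Lambda>2" "h1 = h2" "q1 = q2"
proof -
  show "\<Lambda>1 = \<Lambda>2" using unitary_space_determined(1)[OF _ \<sigma>] assms(1,3) by blast
  show h: "h1 = h2"
    using assms quadratic_space_sesquilinear[OF _ \<sigma>]
    by (intro trace_form_unique) (auto simp: unitary_space_def nondegenerate_quadratic_space_def)
  show "q1 = q2"
    using unitary_space_determined(2)[OF assms(1) \<sigma>] unitary_space_determined(2)[OF assms(3) \<sigma>]
    by (simp add: h fun_eq_iff)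
qed

lemma nondegenerate_form_nonzero:
  assumes "(v::'v) \<noteq> 0"
  shows "\<exists>x y. h x y \<noteq> 0"
proof (rule ccontr)
  assume "\<not> ?thesis"
  then have "(\<lambda>x. h x v) = (\<lambda>x. h x 0)" by simp
  moreover have "inj (\<lambda>y x. h x y)"
    using nondegenerate homeomorphic_imp_injective_map unfolding nondegenerate_form_def by force
  ultimately show False using assms by (metis injD)
qed

text \<open>The trace turns the hermitian symmetry of \<open>h'\<close> into a symmetry of
  \<open>h\<close>, and a nonzero value of \<open>h\<close> compares the two signs. The vector
  \<open>v\<close> guarantees one: on the zero space the form vanishes and says nothing about its
  sign.\<close>

lemma unitary_space_sign:
  assumes U: "unitary_space smul \<sigma> \<epsilon>' \<Lambda>' h' q'" "trace_form_eq h' h" and "(v::'v) \<noteq> 0"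
  shows "\<epsilon>' = incl \<epsilon>"
proof -
  have Q: "quadratic_space smul \<sigma> \<epsilon>' \<Lambda>' h' q'"
    using U by (simp add: unitary_space_def nondegenerate_quadratic_space_def)
  obtain \<delta> where \<delta>: "\<epsilon>' = incl \<delta>" "\<delta> = 1 \<or> \<delta> = - 1"
    using quadratic_space_sign[OF Q] of_prime_field_1 of_prime_field_uminus[of 1] by metis
  have "h x y = \<delta> * h y x" for x y
  proof -
    have "h x y = tr (incl \<delta> * \<sigma> (h' y x))"
      using U(2) quadratic_space_hermitian[OF Q \<sigma>, of x y] unfolding trace_form_eq_def \<delta>(1) by metis
    then show ?thesis
      using U(2)
      by (simp add: prime_trace_scale prime_trace_isom[OF field_involution_isom[OF \<sigma>]] trace_form_eq_def)
  qed
  moreover have "h x y = \<epsilon> * h y x" for x y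
    using quadratic_space_hermitian[OF quadratic field_involution_id, of x y] by simp
  moreover obtain x y where "h y x \<noteq> 0" using nondegenerate_form_nonzero[OF assms(3)] by blast
  ultimately have "\<delta> = \<epsilon>" by (metis mult_right_cancel)
  then show ?thesis by (simp add: \<delta>)
qed

lemma prime_quadratic_value:
  assumes "orthogonal_type id \<epsilon> \<Lambda>" "a \<in> q v"
  shows "q v = {a}" "a + a = h v v"
  using quadratic_space_coset(2)[OF quadratic assms(2)]
    quadratic_space_value[OF quadratic field_involution_id assms(2)] assms(1)
  by (simp_all add: orthogonal_type_def elt_set_plus_def)

lemma symplectic_quadratic_trivial:
  assumes "symplectic_type id \<epsilon> \<Lambda>"
  shows "q v = UNIV" "\<Lambda> = UNIV"
proof -
  show \<Lambda>: "\<Lambda> = UNIV" using assms by (simp add: symplectic_type_def)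
  show "q v = UNIV" using quadratic unfolding \<Lambda> by (rule quadratic_space_UNIV)
qed

text \<open>In the symplectic case the quotient by \<open>\<Lambda>\<close> is trivial. In the
  orthogonal case with p odd, twice tr(a) and twice the value of q are both \<open>h v v\<close>,
  because the trace is invariant under \<open>\<sigma>\<close>.\<close>

lemma unitary_trace_quadratic:
  assumes U: "unitary_space smul \<sigma> (incl \<epsilon>) \<Lambda>' h' q'" "trace_form_eq h' h"
    and type: "CARD('p) \<noteq> 2 \<or> symplectic_type id \<epsilon> \<Lambda>"
  shows "trace_quadratic_eq \<Lambda> q' q"
proof (cases "symplectic_type id \<epsilon> \<Lambda>")
  case True
  show ?thesis
    unfolding trace_quadratic_eq_def symplectic_quadratic_trivial[OF True] elt_set_plus_UNIV by simp
next
  case False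
  then have orth: "orthogonal_type id \<epsilon> \<Lambda>" and p: "CARD('p) \<noteq> 2" using space_type type by auto
  have Q: "quadratic_space smul \<sigma> (incl \<epsilon>) \<Lambda>' h' q'"
    using U by (simp add: unitary_space_def nondegenerate_quadratic_space_def)
  show ?thesis unfolding trace_quadratic_eq_def
  proof (intro allI ballI)
    fix v a assume a: "a \<in> q' v"
    obtain b where b: "b \<in> q v" using quadratic_space_coset(1)[OF quadratic] by blast
    have "tr a + tr a = tr (a + incl \<epsilon> * \<sigma> a)"
      using orth by (simp add: orthogonal_type_def prime_trace_add of_prime_field_1
          prime_trace_isom[OF field_involution_isom[OF \<sigma>]])
    also have "\<dots> = h v v"
      using quadratic_space_value[OF Q \<sigma> a] U(2) by (simp add: trace_form_eq_def)
    finally have "tr a + tr a = b + b" using prime_quadratic_value(2)[OF orth b] by simp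
    then have "2 * tr a = 2 * b" by simp
    then have "tr a = b" using p two_eq_0_iff_mod_ring[where 'p = 'p] by (metis mult_left_cancel)
    then show "q v = tr a +o \<Lambda>"
      using quadratic_space_coset(2)[OF quadratic b] by simp
  qed
qed

section \<open>Trivial involution: the space of the same type\<close>

lemma trace_quadratic_unique:
  assumes Q1: "quadratic_space smul id 1 {0} h' q1" "trace_quadratic_eq {0} q1 q"
    and Q2: "quadratic_space smul id 1 {0} h' q2" "trace_quadratic_eq {0} q2 q"
  shows "q1 = q2"
proof
  fix v
  obtain a b where a: "a \<in> q1 v" and b: "b \<in> q2 v"
    using quadratic_space_coset(1)[OF Q1(1)] quadratic_space_coset(1)[OF Q2(1)] by blast
  \<comment> \<open>In characteristic 2 the form \<open>h'\<close> does not determine these values,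
    so \<open>q\<close> is compared at all multiples \<open>smul c v\<close>, where both sides scale
    by \<open>c * c\<close>.\<close>
  have "a = b"
  proof (rule trace_square_eqI)
    show "a + a = b + b"
      using quadratic_space_value[OF Q1(1) field_involution_id a] quadratic_space_value[OF Q2(1) field_involution_id b]
      by simp
    fix c
    have "q (smul c v) = tr (c * c * a) +o {0}" "q (smul c v) = tr (c * c * b) +o {0}"
      using quadratic_space_scale[OF Q1(1) a, of c] quadratic_space_scale[OF Q2(1) b, of c] Q1(2) Q2(2)
      unfolding trace_quadratic_eq_def id_apply by blast+
    then show "tr (c * c * a) = tr (c * c * b)" by (simp add: elt_set_plus_def)
  qed
  then show "q1 v = q2 v"
    using quadratic_space_coset(2)[OF Q1(1) a] quadratic_space_coset(2)[OF Q2(1) b] by simp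
qed

text \<open>The averaged form \<open>t\<close> still polarises to \<open>h\<close>, because
  \<open>h\<close> is adjoint. For orthogonal spaces it also agrees with \<open>s\<close> on the
  diagonal, by halving for odd p and by symmetry on lines for p = 2; for symplectic ones the
  quotient leaves nothing to check there.\<close>

lemma same_type_space_exists:
  assumes id: "\<sigma> = id"
  shows "\<exists>\<Lambda>' h' q'. nondegenerate_quadratic_space smul id (incl \<epsilon>) \<Lambda>' h' q' \<and>
    same_type id \<epsilon> \<Lambda> (id :: 'k \<Rightarrow> 'k) (incl \<epsilon>) \<Lambda>' \<and> trace_form_eq h' h \<and> trace_quadratic_eq \<Lambda> q' q"
proof -
  obtain s where s: "sesquilinear_form (prime_smul smul) id s"
    and h: "\<And>x y. h x y = s x y + \<epsilon> * s y x" and q: "\<And>v. q v = s v v +o \<Lambda>"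
    using quadratic by (auto simp: quadratic_space_def adjoint_form_def)
  note s_add = sesquilinear_formD(2,3)[OF s]
  have adj: "h (smul a x) y = h x (smul a y)" for a x y using adjoint id by simp
  obtain n :: nat and u w :: "nat \<Rightarrow> 'k"
    where "\<forall>x. (\<Sum>i<n. incl (tr (x * w i)) * u i) = x" "\<forall>x. (\<Sum>i<n. incl (tr (x * u i)) * w i) = x"
    using trace_dual_bases by (elim exE conjE) (rule that)
  note uw = this[rule_format]
  define t where "t x y = (\<Sum>i<n. s (smul (u i) x) (smul (w i) y))" for x y
  define s' where "s' = trace_lift smul t"
  define h' where "h' x y = s' x y + incl \<epsilon> * s' y x" for x y
  \<comment> \<open>The type is read off with \<open>\<Lambda>\<close> included, since for p = 2 the
    sign does not separate the two types.\<close>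
  define \<Lambda>' :: "'k set" where "\<Lambda>' = (if orthogonal_type id \<epsilon> \<Lambda> then {0} else UNIV)"
  have t_add: "t (x + x') y = t x y + t x' y" "t x (y + y') = t x y + t x y'" for x x' y y'
    by (simp_all add: t_def vector_spaceD[OF smul] s_add sum.distrib)
  have \<beta>_add: "s (smul (a + a') x) (smul b y) = s (smul a x) (smul b y) + s (smul a' x) (smul b y)"
    "s (smul a x) (smul (b + b') y) = s (smul a x) (smul b y) + s (smul a x) (smul b' y)" for a a' b b' x y
    by (simp_all add: vector_spaceD[OF smul] s_add)
  have "continuous_map euclidean (discrete_topology UNIV) (\<lambda>(x, y). t x y)"
  proof (rule continuous_map_discrete_factor[where A = "{..<n}" and
        f = "\<lambda>i (x, y). s (smul (u i) x) (smul (w i) y)"])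
    show "continuous_map euclidean (discrete_topology UNIV) (\<lambda>(x, y). s (smul (u i) x) (smul (w i) y))" for i
      by (rule continuous_map_form_smul[OF sesquilinear_formD(1)[OF s] V])
  qed (auto simp: t_def case_prod_beta')
  moreover have t_adj: "t (smul a x) y = t x (smul a y)" for a x y
    using dual_bases_balanced[OF uw, where \<beta> = "\<lambda>b c. s (smul b x) (smul c y)" and a = a, OF \<beta>_add]
    by (simp add: t_def vector_spaceD[OF smul])
  ultimately have s': "sesquilinear_form smul id s'"
    unfolding s'_def by (intro sesquilinear_trace_lift[OF V]) (simp_all add: t_add)
  have tr_s': "tr (s' x y) = t x y" for x y
    using trace_lift[OF smul, of t 1 x y] t_add by (simp add: s'_def vector_spaceD[OF smul])
  \<comment> \<open>Exchanging the two bases in \<open>t y x\<close> aligns its summands with those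
    of \<open>t x y\<close>, so that they pair up to values of \<open>h\<close>. Adjointness
    collects all scalars into sum_i u_i w_i = 1.\<close>
  have polar: "t x y + \<epsilon> * t y x = h x y" for x y
  proof -
    have "t y x = (\<Sum>i<n. s (smul (w i) y) (smul (u i) x))"
      unfolding t_def
      by (rule dual_bases_swap[OF uw, where \<beta> = "\<lambda>b c. s (smul b y) (smul c x)", OF \<beta>_add])
    then have "t x y + \<epsilon> * t y x = (\<Sum>i<n. h (smul (u i) x) (smul (w i) y))"
      by (simp add: t_def h sum.distrib sum_distrib_left)
    also have "\<dots> = (\<Sum>i<n. h (smul (u i * w i) x) y)"
      by (simp add: adj[symmetric] vector_spaceD[OF smul] mult.commute)
    also have "\<dots> = h (smul (\<Sum>i<n. u i * w i) x) y"
    proof -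
      have "h 0 y = 0" using sesquilinear_formD(4)[OF form_sesquilinear, of 0 0 y]
        by (simp add: vector_spaceD[OF vector_space_prime_smul[OF smul]])
      then have "(\<Sum>i<m. h (smul (f i) x) y) = h (smul (\<Sum>i<m. f i) x) y" for m and f :: "nat \<Rightarrow> 'k"
        by (induction m) (simp_all add: vector_spaceD[OF smul] sesquilinear_formD(2)[OF form_sesquilinear])
      then show ?thesis .
    qed
    finally show ?thesis by (simp add: dual_bases_sum_mult[OF uw] vector_spaceD[OF smul])
  qed
  have tr_h': "trace_form_eq h' h"
    by (simp add: trace_form_eq_def h'_def prime_trace_add prime_trace_scale tr_s' polar)
  have type: "same_type id \<epsilon> \<Lambda> (id :: 'k \<Rightarrow> 'k) (incl \<epsilon>) \<Lambda>'"
    using space_type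
    by (auto simp: same_type_def orthogonal_type_def symplectic_type_def \<Lambda>'_def
        of_prime_field_1 of_prime_field_uminus)
  then have "form_parameter id (incl \<epsilon>) \<Lambda>'"
    by (auto simp: same_type_def orthogonal_type_def symplectic_type_def form_parameter_def)
  then have Q: "quadratic_space smul id (incl \<epsilon>) \<Lambda>' h' (\<lambda>v. s' v v +o \<Lambda>')"
    using sign_prime_field s' unfolding quadratic_space_def
    by (intro conjI exI[of _ s']) (auto simp: h'_def adjoint_form_def fun_eq_iff)
  have "nondegenerate_form smul h'"
    by (rule nondegenerate_trace_form[OF V quadratic_space_sesquilinear[OF Q field_involution_id] tr_h' nondegenerate])
  moreover have "trace_quadratic_eq \<Lambda> (\<lambda>v. s' v v +o \<Lambda>') q"
  proof (cases "orthogonal_type id \<epsilon> \<Lambda>")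
    case True
    then have \<epsilon>: "\<epsilon> = 1" and \<Lambda>: "\<Lambda> = {0}" by (simp_all add: orthogonal_type_def)
    have "t v v = s v v" for v
    proof (cases "CARD('p) = 2")
      case p: True
      then have "(2 :: 'p mod_ring) = 0" by (simp add: two_eq_0_iff_mod_ring)
      then have twice: "x + x = 0" for x :: "'p mod_ring" by (simp flip: mult_2)
      \<comment> \<open>Writing \<open>d\<close> as a square a^2 turns this value into h(av,av) = 2
        s(av,av). Vanishing of \<open>h\<close> on the line is what makes \<open>s\<close> symmetric
        there.\<close>
      have alt: "h (smul d v) v = 0" for d
      proof -
        obtain a where "a * a = d" by (rule square_in_char_2[OF p])
        then have "h (smul d v) v = h (smul a v) (smul a v)"
          by (metis adj vector_spaceD(3)[OF smul])
        then show ?thesis by (simp add: h \<epsilon> twice)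
      qed
      have "s (smul b v) (smul c v) = s (smul c v) (smul b v)" for b c
      proof -
        have "h (smul b v) (smul c v) = 0"
          using alt[of "c * b"] by (simp add: adj[symmetric] vector_spaceD[OF smul])
        then have "s (smul b v) (smul c v) + s (smul c v) (smul b v) = s (smul c v) (smul b v) + s (smul c v) (smul b v)"
          by (simp add: h \<epsilon> twice)
        then show ?thesis by simp
      qed
      then show ?thesis
        using dual_bases_symmetric_char_2[OF uw, where \<beta> = "\<lambda>b c. s (smul b v) (smul c v)", OF \<beta>_add p]
        by (simp add: t_def vector_spaceD[OF smul])
    next
      case False
      then have "(2 :: 'p mod_ring) \<noteq> 0" by (simp add: two_eq_0_iff_mod_ring)
      moreover have "2 * t v v = 2 * s v v"
        using polar[of v v] h[of v v] by (simp add: \<epsilon>)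
      ultimately show ?thesis by simp
    qed
    then show ?thesis
      using True by (auto simp: trace_quadratic_eq_def q \<Lambda> \<Lambda>'_def elt_set_plus_def tr_s')
  next
    case False
    then have type: "symplectic_type id \<epsilon> \<Lambda>" using space_type by simp
    show ?thesis
      unfolding trace_quadratic_eq_def symplectic_quadratic_trivial[OF type] elt_set_plus_UNIV by simp
  qed
  ultimately show ?thesis
    using Q type tr_h' unfolding nondegenerate_quadratic_space_def by blast
qed

lemma same_type_space_unique:
  assumes id: "\<sigma> = id"
    and 1: "nondegenerate_quadratic_space smul \<sigma> \<epsilon>1 \<Lambda>1 h1 q1" "same_type id \<epsilon> \<Lambda> \<sigma> \<epsilon>1 \<Lambda>1"
      "trace_form_eq h1 h" "trace_quadratic_eq \<Lambda> q1 q"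
    and 2: "nondegenerate_quadratic_space smul \<sigma> \<epsilon>2 \<Lambda>2 h2 q2" "same_type id \<epsilon> \<Lambda> \<sigma> \<epsilon>2 \<Lambda>2"
      "trace_form_eq h2 h" "trace_quadratic_eq \<Lambda> q2 q"
  shows "\<epsilon>1 = \<epsilon>2" "\<Lambda>1 = \<Lambda>2" "h1 = h2" "q1 = q2"
proof -
  have Q: "quadratic_space smul id \<epsilon>1 \<Lambda>1 h1 q1" "quadratic_space smul id \<epsilon>2 \<Lambda>2 h2 q2"
    using 1(1) 2(1) id by (simp_all add: nondegenerate_quadratic_space_def)
  have *: "\<Lambda> = {0} \<and> \<epsilon>1 = 1 \<and> \<epsilon>2 = 1 \<and> \<Lambda>1 = {0} \<and> \<Lambda>2 = {0} \<or>
      \<epsilon>1 = - 1 \<and> \<epsilon>2 = - 1 \<and> \<Lambda>1 = UNIV \<and> \<Lambda>2 = UNIV"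
  proof -
    \<comment> \<open>Separates the parameters \<open>{0}\<close> and \<open>UNIV\<close>, so the
      two types exclude each other even when 1 = -1.\<close>
    have "(1 :: 'p mod_ring) \<notin> {0}" by simp
    then have "\<not> (orthogonal_type id \<epsilon> \<Lambda> \<and> symplectic_type id \<epsilon> \<Lambda>)"
      by (auto simp only: orthogonal_type_def symplectic_type_def)
    then have "orthogonal_type id \<epsilon> \<Lambda> \<and> orthogonal_type \<sigma> \<epsilon>1 \<Lambda>1 \<and> orthogonal_type \<sigma> \<epsilon>2 \<Lambda>2 \<or>
        symplectic_type \<sigma> \<epsilon>1 \<Lambda>1 \<and> symplectic_type \<sigma> \<epsilon>2 \<Lambda>2"
      using 1(2) 2(2) unfolding same_type_def by blast
    then show ?thesis unfolding orthogonal_type_def symplectic_type_def by blast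
  qed
  then show "\<epsilon>1 = \<epsilon>2" "\<Lambda>1 = \<Lambda>2" by auto
  show h: "h1 = h2"
    using quadratic_space_sesquilinear[OF Q(1) field_involution_id] 1(3)
      quadratic_space_sesquilinear[OF Q(2) field_involution_id] 2(3)
    by (rule trace_form_unique)
  show "q1 = q2"
    using *
  proof (elim disjE conjE)
    assume "\<Lambda> = {0}" "\<epsilon>1 = 1" "\<epsilon>2 = 1" "\<Lambda>1 = {0}" "\<Lambda>2 = {0}"
    then show ?thesis
      using trace_quadratic_unique[of h1 q1 q2] Q 1(4) 2(4) by (simp add: h)
  next
    assume "\<Lambda>1 = UNIV" "\<Lambda>2 = UNIV"
    then have "q1 v = UNIV" "q2 v = UNIV" for v
      using Q by (simp_all add: quadratic_space_UNIV)
    then show ?thesis by (simp add: fun_eq_iff)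
  qed
qed

section \<open>Maximal isotropic subspaces\<close>

lemma orthogonal_complement_trace:
  assumes h': "sesquilinear_form smul \<sigma>' h'" "trace_form_eq h' h" and X: "module.subspace smul X"
  shows "orthogonal_complement h X = orthogonal_complement h' X"
proof -
  have "h' x y = 0" if "\<forall>x\<in>X. h x y = 0" "x \<in> X" for x y
  proof (rule prime_trace_eqI)
    fix b
    interpret vector_space smul by (rule smul)
    \<comment> \<open>Stability of \<open>X\<close> under \<open>k\<close> is essential: vanishing
      of \<open>h\<close> at all multiples of \<open>x\<close> kills the trace of every multiple of
      \<open>h' x y\<close>.\<close>
    have "smul b x \<in> X" using X that(2) by (rule subspace_scale)
    then have "tr (h' (smul b x) y) = 0" using that(1) h'(2) by (simp add: trace_form_eq_def)
    then show "tr (b * h' x y) = tr (b * 0)"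
      by (simp add: sesquilinear_formD[OF h'(1)] prime_trace_0)
  qed
  moreover have "h x y = 0" if "h' x y = 0" for x y
    using h'(2) that prime_trace_0 by (metis trace_form_eq_def)
  ultimately show ?thesis unfolding orthogonal_complement_def by blast
qed

text \<open>The quadratic conditions need comparing only when \<open>X\<close> equals its orthogonal
  complement, which is why \<open>isotropic_iff\<close> may presuppose that both forms vanish on the
  diagonal of \<open>X\<close>.\<close>

lemma maximal_isotropic_trace_iff:
  assumes h': "sesquilinear_form smul \<sigma>' h'" "trace_form_eq h' h" and X: "module.subspace smul X"
    and isotropic_iff: "(\<And>x. x \<in> X \<Longrightarrow> h x x = 0) \<Longrightarrow> (\<And>x. x \<in> X \<Longrightarrow> h' x x = 0) \<Longrightarrow>
      (\<forall>x\<in>X. q x = \<Lambda>) \<longleftrightarrow> (\<forall>x\<in>X. q' x = \<Lambda>')"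
  shows "maximal_isotropic \<Lambda> h q X \<longleftrightarrow> maximal_isotropic \<Lambda>' h' q' X"
proof -
  have "(\<forall>x\<in>X. q x = \<Lambda>) \<longleftrightarrow> (\<forall>x\<in>X. q' x = \<Lambda>')" if "X = orthogonal_complement h X"
    using that orthogonal_complement_trace[OF h' X]
    by (intro isotropic_iff) (auto simp: orthogonal_complement_def)
  then show ?thesis
    unfolding maximal_isotropic_def isotropic_def orthogonal_complement_trace[OF h' X, symmetric] by blast
qed

text \<open>Both quadratic conditions hold automatically once the diagonals vanish:
  \<open>q' x\<close> is the fibre over 0, hence contains 0, and \<open>q x\<close> is trivial by
  the symplectic quotient, by dividing by 2, or, for p = 2 orthogonal, as the trace of 0.\<close>

lemma unitary_maximal_isotropic_iff:
  assumes U: "unitary_space smul \<sigma> \<epsilon>' \<Lambda>' h' q'" "trace_form_eq h' h"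
    and q': "CARD('p) = 2 \<and> orthogonal_type id \<epsilon> \<Lambda> \<longrightarrow> trace_quadratic_eq \<Lambda> q' q"
    and X: "module.subspace smul X"
  shows "maximal_isotropic \<Lambda> h q X \<longleftrightarrow> maximal_isotropic \<Lambda>' h' q' X"
proof (rule maximal_isotropic_trace_iff[OF _ U(2) X])
  have Q: "quadratic_space smul \<sigma> \<epsilon>' \<Lambda>' h' q'"
    using U by (simp add: unitary_space_def nondegenerate_quadratic_space_def)
  show "sesquilinear_form smul \<sigma> h'" by (rule quadratic_space_sesquilinear[OF Q \<sigma>])
  assume zero: "\<And>x. x \<in> X \<Longrightarrow> h x x = 0" and zero': "\<And>x. x \<in> X \<Longrightarrow> h' x x = 0"
  have q'0: "0 \<in> q' x" if "x \<in> X" for x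
    using unitary_space_determined(2)[OF U(1) \<sigma>, of x] zero'[OF that] by (simp add: field_involutionD[OF \<sigma>])
  have "q x = \<Lambda>" if "x \<in> X" for x
  proof (cases "symplectic_type id \<epsilon> \<Lambda>")
    case True
    then show ?thesis using symplectic_quadratic_trivial by simp
  next
    case False
    then have orth: "orthogonal_type id \<epsilon> \<Lambda>" using space_type by simp
    show ?thesis
    proof (cases "CARD('p) = 2")
      case True
      then have "q x = tr 0 +o \<Lambda>" using q' orth q'0[OF that] by (simp add: trace_quadratic_eq_def)
      then show ?thesis by (simp add: prime_trace_0 elt_set_plus_def)
    next
      case False
      then have 2: "(2 :: 'p mod_ring) \<noteq> 0" by (simp add: two_eq_0_iff_mod_ring)
      obtain b where b: "b \<in> q x" using quadratic_space_coset(1)[OF quadratic] by blast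
      have "2 * b = 0" using prime_quadratic_value(2)[OF orth b] zero[OF that] by simp
      then show ?thesis using b 2 quadratic_space_coset(3)[OF quadratic, of x] by simp
    qed
  qed
  then show "(\<forall>x\<in>X. q x = \<Lambda>) \<longleftrightarrow> (\<forall>x\<in>X. q' x = \<Lambda>')"
    using q'0 quadratic_space_coset(3)[OF Q] by blast
qed

lemma same_type_maximal_isotropic_iff:
  assumes Q: "nondegenerate_quadratic_space smul \<sigma> \<epsilon>' \<Lambda>' h' q'" "same_type id \<epsilon> \<Lambda> \<sigma> \<epsilon>' \<Lambda>'"
      "trace_form_eq h' h" "trace_quadratic_eq \<Lambda> q' q"
    and X: "module.subspace smul X"
  shows "maximal_isotropic \<Lambda> h q X \<longleftrightarrow> maximal_isotropic \<Lambda>' h' q' X"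
proof (rule maximal_isotropic_trace_iff[OF _ Q(3) X])
  have quad: "quadratic_space smul \<sigma> \<epsilon>' \<Lambda>' h' q'"
    using Q(1) by (simp add: nondegenerate_quadratic_space_def)
  show "sesquilinear_form smul \<sigma> h'" by (rule quadratic_space_sesquilinear[OF quad \<sigma>])
  assume zero': "\<And>x. x \<in> X \<Longrightarrow> h' x x = 0"
  show "(\<forall>x\<in>X. q x = \<Lambda>) \<longleftrightarrow> (\<forall>x\<in>X. q' x = \<Lambda>')"
  proof (cases "symplectic_type id \<epsilon> \<Lambda> \<and> symplectic_type \<sigma> \<epsilon>' \<Lambda>'")
    case True
    then have "\<Lambda>' = UNIV" by (simp add: symplectic_type_def)
    then have "q' x = \<Lambda>'" for x
      using quad by (simp add: quadratic_space_UNIV)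
    then show ?thesis using True symplectic_quadratic_trivial by simp
  next
    case False
    then have \<sigma>_id: "\<sigma> = id" and \<epsilon>': "\<epsilon>' = 1" and \<Lambda>: "\<Lambda> = {0}" "\<Lambda>' = {0}"
      using Q(2) by (auto simp: same_type_def orthogonal_type_def)
    show ?thesis
    proof (intro iffI ballI)
      fix x assume x: "x \<in> X" and zero: "\<forall>x\<in>X. q' x = \<Lambda>'"
      then have "q x = tr 0 +o \<Lambda>" using Q(4) by (simp add: trace_quadratic_eq_def \<Lambda>)
      then show "q x = \<Lambda>" by (simp add: prime_trace_0 elt_set_plus_def)
    next
      fix x assume x: "x \<in> X" and zero: "\<forall>x\<in>X. q x = \<Lambda>"
      obtain a where a: "a \<in> q' x" using quadratic_space_coset(1)[OF quad] by blast
      \<comment> \<open>A zero trace at \<open>x\<close> alone would not suffice; \<open>q\<close>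
        vanishes at every multiple \<open>smul c x\<close>, which gives tr(c^2 a) = 0 for all
        \<open>c\<close>.\<close>
      have "a = 0"
      proof (rule trace_square_eqI)
        show "a + a = 0 + 0"
          using quadratic_space_value[OF quad \<sigma> a] zero'[OF x] by (simp add: \<sigma>_id \<epsilon>')
        fix c
        interpret vector_space smul by (rule smul)
        have "smul c x \<in> X" using X x by (rule subspace_scale)
        moreover have "c * c * a \<in> q' (smul c x)"
          using quadratic_space_scale[OF quad a, of c] by (simp add: \<sigma>_id)
        ultimately have "\<Lambda> = tr (c * c * a) +o \<Lambda>" using Q(4) zero by (metis trace_quadratic_eq_def)
        then show "tr (c * c * a) = tr (c * c * 0)" by (simp add: \<Lambda> elt_set_plus_def prime_trace_0)
      qed
      then show "q' x = \<Lambda>'" using a quadratic_space_coset(3)[OF quad] by blast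
    qed
  qed
qed

end

end

text \<open>In the unitary case existence and uniqueness are stated for the sign of
  \<open>h\<close>, and the sign is shown to be forced on a nonzero space; the vanishing form on the
  zero space does not determine it. With the trivial involution the type fixes the sign, which is
  therefore part of the unique tuple.\<close>

theorem theorem2p16:
  fixes \<sigma> :: "'k::finite_field \<Rightarrow> 'k"
    and smul :: "'k \<Rightarrow> 'v::{topological_ab_group_add,t2_space} \<Rightarrow> 'v"
    and \<epsilon> :: "'p::prime_card mod_ring"
    and \<Lambda> :: "'p mod_ring set"
    and h :: "'v \<Rightarrow> 'v \<Rightarrow> 'p mod_ring"
    and q :: "'v \<Rightarrow> 'p mod_ring set"
  assumes char: "CHAR('k) = CARD('p)"
    and involution: "field_involution \<sigma>"
    and V: "locally_compact_vector_space smul"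
    and space: "nondegenerate_quadratic_space (prime_smul smul) id \<epsilon> \<Lambda> h q"
    and adjoint: "\<forall>a x y. h (smul a x) y = h x (smul (\<sigma> a) y)"
  shows
    "(\<sigma> \<noteq> id \<longrightarrow>
       (\<exists>!(\<Lambda>', h', q'). unitary_space smul \<sigma> (of_prime_field \<epsilon>) \<Lambda>' h' q' \<and> trace_form_eq h' h) \<and>
       (\<forall>\<epsilon>' \<Lambda>' h' q'. unitary_space smul \<sigma> \<epsilon>' \<Lambda>' h' q' \<and> trace_form_eq h' h \<and> (\<exists>v::'v. v \<noteq> 0)
          \<longrightarrow> \<epsilon>' = of_prime_field \<epsilon>) \<and>
       (\<forall>\<Lambda>' h' q'. unitary_space smul \<sigma> (of_prime_field \<epsilon>) \<Lambda>' h' q' \<and> trace_form_eq h' h \<and>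
          (CARD('p) \<noteq> 2 \<or> symplectic_type id \<epsilon> \<Lambda>)
          \<longrightarrow> trace_quadratic_eq \<Lambda> q' q))
     \<and>
     (\<sigma> = id \<longrightarrow>
       (\<exists>!(\<epsilon>', \<Lambda>', h', q'). nondegenerate_quadratic_space smul \<sigma> \<epsilon>' \<Lambda>' h' q' \<and>
          same_type id \<epsilon> \<Lambda> \<sigma> \<epsilon>' \<Lambda>' \<and> trace_form_eq h' h \<and> trace_quadratic_eq \<Lambda> q' q))
     \<and>
     (\<forall>\<epsilon>' \<Lambda>' h' q' X.
        (unitary_space smul \<sigma> \<epsilon>' \<Lambda>' h' q' \<and> trace_form_eq h' h \<or>
         nondegenerate_quadratic_space smul \<sigma> \<epsilon>' \<Lambda>' h' q' \<and>
           same_type id \<epsilon> \<Lambda> \<sigma> \<epsilon>' \<Lambda>' \<and> trace_form_eq h' h \<and> trace_quadratic_eq \<Lambda> q' q) \<and>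
        (CARD('p) = 2 \<and> \<sigma> \<noteq> id \<and> orthogonal_type id \<epsilon> \<Lambda> \<longrightarrow> trace_quadratic_eq \<Lambda> q' q) \<and>
        closed_subspace smul X
        \<longrightarrow> (maximal_isotropic \<Lambda> h q X \<longleftrightarrow> maximal_isotropic \<Lambda>' h' q' X))"
proof (intro conjI impI)
  note setting = char involution V space adjoint
  show "\<exists>!(\<Lambda>', h', q'). unitary_space smul \<sigma> (of_prime_field \<epsilon>) \<Lambda>' h' q' \<and> trace_form_eq h' h" if nontrivial: "\<sigma> \<noteq> id"
  proof -
    obtain \<Lambda>' h' q' where *: "unitary_space smul \<sigma> (of_prime_field \<epsilon>) \<Lambda>' h' q'" "trace_form_eq h' h"
      using unitary_space_exists[OF setting nontrivial] by blast
    show ?thesis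
    proof (rule ex1I[of _ "(\<Lambda>', h', q')"])
      fix z assume "case z of (\<Lambda>', h', q') \<Rightarrow>
        unitary_space smul \<sigma> (of_prime_field \<epsilon>) \<Lambda>' h' q' \<and> trace_form_eq h' h"
      then show "z = (\<Lambda>', h', q')"
        using unitary_space_unique[OF setting _ _ *] by (cases z) (auto)
    qed (use * in simp)
  qed
  show "\<forall>\<epsilon>' \<Lambda>' h' q'. unitary_space smul \<sigma> \<epsilon>' \<Lambda>' h' q' \<and> trace_form_eq h' h \<and> (\<exists>v::'v. v \<noteq> 0)
      \<longrightarrow> \<epsilon>' = of_prime_field \<epsilon>"
    using unitary_space_sign[OF setting] by blast
  show "\<forall>\<Lambda>' h' q'. unitary_space smul \<sigma> (of_prime_field \<epsilon>) \<Lambda>' h' q' \<and> trace_form_eq h' h \<and>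
      (CARD('p) \<noteq> 2 \<or> symplectic_type id \<epsilon> \<Lambda>) \<longrightarrow> trace_quadratic_eq \<Lambda> q' q"
    using unitary_trace_quadratic[OF setting] by blast
  show "\<exists>!(\<epsilon>', \<Lambda>', h', q'). nondegenerate_quadratic_space smul \<sigma> \<epsilon>' \<Lambda>' h' q' \<and>
      same_type id \<epsilon> \<Lambda> \<sigma> \<epsilon>' \<Lambda>' \<and> trace_form_eq h' h \<and> trace_quadratic_eq \<Lambda> q' q" if id: "\<sigma> = id"
  proof -
    obtain \<Lambda>' h' q' where *: "nondegenerate_quadratic_space smul \<sigma> (of_prime_field \<epsilon>) \<Lambda>' h' q'"
      "same_type id \<epsilon> \<Lambda> \<sigma> (of_prime_field \<epsilon>) \<Lambda>'" "trace_form_eq h' h" "trace_quadratic_eq \<Lambda> q' q"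
      using same_type_space_exists[OF setting id] id by blast
    show ?thesis
    proof (rule ex1I[of _ "(of_prime_field \<epsilon>, \<Lambda>', h', q')"])
      fix z assume "case z of (\<epsilon>', \<Lambda>', h', q') \<Rightarrow> nondegenerate_quadratic_space smul \<sigma> \<epsilon>' \<Lambda>' h' q' \<and>
        same_type id \<epsilon> \<Lambda> \<sigma> \<epsilon>' \<Lambda>' \<and> trace_form_eq h' h \<and> trace_quadratic_eq \<Lambda> q' q"
      then show "z = (of_prime_field \<epsilon>, \<Lambda>', h', q')"
        using same_type_space_unique[OF setting id _ _ _ _ *] by (cases z) auto
    qed (use * in simp)
  qed
  show "\<forall>\<epsilon>' \<Lambda>' h' q' X.
      (unitary_space smul \<sigma> \<epsilon>' \<Lambda>' h' q' \<and> trace_form_eq h' h \<or>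
       nondegenerate_quadratic_space smul \<sigma> \<epsilon>' \<Lambda>' h' q' \<and>
         same_type id \<epsilon> \<Lambda> \<sigma> \<epsilon>' \<Lambda>' \<and> trace_form_eq h' h \<and> trace_quadratic_eq \<Lambda> q' q) \<and>
      (CARD('p) = 2 \<and> \<sigma> \<noteq> id \<and> orthogonal_type id \<epsilon> \<Lambda> \<longrightarrow> trace_quadratic_eq \<Lambda> q' q) \<and>
      closed_subspace smul X
      \<longrightarrow> (maximal_isotropic \<Lambda> h q X \<longleftrightarrow> maximal_isotropic \<Lambda>' h' q' X)"
    using unitary_maximal_isotropic_iff[OF setting] same_type_maximal_isotropic_iff[OF setting]
    unfolding closed_subspace_def unitary_space_def by blast
qed

end
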